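(* Let $T$ be a tree of order $n\ge 3$ with $\iota(\mathrm{Mid}(T))=\lfloor \frac{n-1}{2}\rfloor$. Then: (i) if $3\le n\le 4$, $T$ is the path $P_n$ or the star $K_{1,3}$; (ii) if $n\ge 5$ and $n$ is odd, $T$ is the spider $S_k$ with $k=\frac{n-1}{2}\ge 2$; (iii) if $n\ge 6$, $n$ is even and $\mathrm{Diam}(T)\le 4$, then $T$ has a leaf $w$ such that $T-w$ is isomorphic to the spider $S_k$ for some $k\ge 2$; (iv) if $n\ge 6$, $n$ is even and $\mathrm{Diam}(T)\ge 5$, then $T$ is one of the following: (a) a tree obtained from a path $u_0u_1u_2u_3u_4u_5$ by adding some number $r\ge 0$ of new disjoint edges $x_iy_i$ together with an edge joining $x_i$ to a vertex of $\{u_2,u_3\}$ for each $i$; (b) a tree obtained from a path $u_0u_1\cdots u_6$ by adding a new leaf $v$ adjacent to $u_3$ and some number $r\ge 0$ of new disjoint edges $x_iy_i$ together with an edge joining $x_i$ to a vertex of $\{u_2,u_4\}$ for each $i$; (c) a tree obtained from a path $u_0u_1\cdots u_7$ by adding some number $r\ge 0$ of new disjoint edges $x_iy_i$ together with an edge joining $x_i$ to a vertex of $\{u_2,u_5\}$ for each $i$.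
   Context: For a graph $H$ and $S\subseteq V(H)$, let $N_H[S]$ be $S$ together with all vertices adjacent to a vertex of $S$. A set $S\subseteq V(H)$ is an isolating set of $H$ if $V(H)\setminus N_H[S]$ is an independent set of $H$; $\iota(H)$ is the minimum size of an isolating set of $H$. The middle graph $\mathrm{Mid}(G)$ has vertex set $V(G)\cup\{m_e: e\in E(G)\}$, with $v\sim m_e$ iff $v$ is an endpoint of $e$, $m_e\sim m_f$ iff distinct edges $e,f$ share an endpoint, and no edges between vertices of $V(G)$. $\mathrm{Diam}(T)$ is the maximum distance between two vertices of $T$. For $k\ge 2$, the spider $S_k$ is the tree of order $2k+1$ obtained from the star $K_{1,k}$ by subdividing each edge exactly once (a center adjacent to $k$ vertices of degree 2, each adjacent to a distinct leaf). *)

theory Defs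
  imports Main
begin

datatype 'a graph = Graph (verts: "'a set") (edges: "'a set set")

definition simple_graph :: "'a graph \<Rightarrow> bool" where
  "simple_graph G \<longleftrightarrow>
     finite (verts G) \<and> (\<forall>e\<in>edges G. e \<subseteq> verts G \<and> card e = 2)"

definition adj :: "'a graph \<Rightarrow> 'a \<Rightarrow> 'a \<Rightarrow> bool" where
  "adj G u v \<longleftrightarrow> {u, v} \<in> edges G"

definition degree :: "'a graph \<Rightarrow> 'a \<Rightarrow> nat" where
  "degree G v = card {u \<in> verts G. adj G v u}"

definition leaf :: "'a graph \<Rightarrow> 'a \<Rightarrow> bool" where
  "leaf G v \<longleftrightarrow> v \<in> verts G \<and> degree G v = 1"

definition graph_iso :: "'a graph \<Rightarrow> 'b graph \<Rightarrow> bool" where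
  "graph_iso G H \<longleftrightarrow>
     (\<exists>f. bij_betw f (verts G) (verts H) \<and>
          (\<forall>u\<in>verts G. \<forall>v\<in>verts G. adj G u v \<longleftrightarrow> adj H (f u) (f v)))"

definition walk :: "'a graph \<Rightarrow> 'a \<Rightarrow> 'a list \<Rightarrow> 'a \<Rightarrow> bool" where
  "walk G u p v \<longleftrightarrow>
     p \<noteq> [] \<and> hd p = u \<and> last p = v \<and> set p \<subseteq> verts G \<and> successively (adj G) p"

definition connected :: "'a graph \<Rightarrow> bool" where
  "connected G \<longleftrightarrow>
     verts G \<noteq> {} \<and> (\<forall>u\<in>verts G. \<forall>v\<in>verts G. \<exists>p. walk G u p v)"

text \<open>A cycle is listed without repeating its first vertex at the end.\<close>

definition cycle :: "'a graph \<Rightarrow> 'a list \<Rightarrow> bool" where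
  "cycle G p \<longleftrightarrow>
     length p \<ge> 3 \<and> distinct p \<and> walk G (hd p) p (last p) \<and> adj G (last p) (hd p)"

definition tree :: "'a graph \<Rightarrow> bool" where
  "tree G \<longleftrightarrow> simple_graph G \<and> connected G \<and> \<not> (\<exists>p. cycle G p)"

text \<open>Meaningful for vertices in the same component; a walk with vertex list
  \<^term>\<open>p\<close> has \<^term>\<open>length p - 1\<close> edges.\<close>

definition dist :: "'a graph \<Rightarrow> 'a \<Rightarrow> 'a \<Rightarrow> nat" where
  "dist G u v = (LEAST d. \<exists>p. walk G u p v \<and> length p - 1 = d)"

definition diam :: "'a graph \<Rightarrow> nat" where
  "diam G = Max {dist G u v | u v. u \<in> verts G \<and> v \<in> verts G}"

definition closed_nbhd :: "'a graph \<Rightarrow> 'a set \<Rightarrow> 'a set" where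
  "closed_nbhd G S = S \<union> {v \<in> verts G. \<exists>u\<in>S. adj G u v}"

definition independent_set :: "'a graph \<Rightarrow> 'a set \<Rightarrow> bool" where
  "independent_set G I \<longleftrightarrow> I \<subseteq> verts G \<and> (\<forall>u\<in>I. \<forall>v\<in>I. \<not> adj G u v)"

definition isolating_set :: "'a graph \<Rightarrow> 'a set \<Rightarrow> bool" where
  "isolating_set G S \<longleftrightarrow>
     S \<subseteq> verts G \<and> independent_set G (verts G - closed_nbhd G S)"

definition isolation_number :: "'a graph \<Rightarrow> nat" where
  "isolation_number G = Min {card S | S. isolating_set G S}"

text \<open>The vertex \<open>m\<^sub>e\<close> is \<^term>\<open>Inr e\<close>.\<close>

definition middle_graph :: "'a graph \<Rightarrow> ('a + 'a set) graph" where
  "middle_graph G = Graph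
     (Inl ` verts G \<union> Inr ` edges G)
     ({{Inl v, Inr e} | v e. v \<in> verts G \<and> e \<in> edges G \<and> v \<in> e} \<union>
      {{Inr e, Inr f} | e f. e \<in> edges G \<and> f \<in> edges G \<and> e \<noteq> f \<and> e \<inter> f \<noteq> {}})"

definition path_on :: "'a list \<Rightarrow> 'a graph" where
  "path_on us = Graph (set us) {{us ! i, us ! Suc i} | i. Suc i < length us}"

definition path_graph :: "nat \<Rightarrow> nat graph" where
  "path_graph n = path_on [0..<n]"

definition star_graph :: "nat \<Rightarrow> nat graph" where
  "star_graph k = Graph {0..k} {{0, i} | i. i \<in> {1..k}}"

text \<open>Every edge \<^term>\<open>e\<close> is subdivided exactly once, by the new vertex \<^term>\<open>Inr e\<close>.\<close>

definition subdivide_edges :: "'a graph \<Rightarrow> ('a + 'a set) graph" where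
  "subdivide_edges G = Graph
     (Inl ` verts G \<union> Inr ` edges G)
     {{Inl v, Inr e} | v e. v \<in> verts G \<and> e \<in> edges G \<and> v \<in> e}"

definition spider :: "nat \<Rightarrow> (nat + nat set) graph" where
  "spider k = subdivide_edges (star_graph k)"

definition delete_vertex :: "'a graph \<Rightarrow> 'a \<Rightarrow> 'a graph" where
  "delete_vertex G w = Graph (verts G - {w}) {e \<in> edges G. w \<notin> e}"

text \<open>Adds \<^term>\<open>v\<close>, intended to be new, as a leaf adjacent to \<^term>\<open>u\<close>.\<close>

definition add_leaf :: "'a graph \<Rightarrow> 'a \<Rightarrow> 'a \<Rightarrow> 'a graph" where
  "add_leaf G u v = Graph (insert v (verts G)) (insert {u, v} (edges G))"

text \<open>\<^term>\<open>H\<close> arises from \<^term>\<open>G\<close> by adding \<open>r \<ge> 0\<close> new disjoint edges \<open>x\<^sub>i y\<^sub>i\<close> and, for each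
  \<open>i\<close>, an edge from \<open>x\<^sub>i\<close> to some vertex \<open>a\<^sub>i\<close> of \<^term>\<open>A\<close>.\<close>

definition attach_edges :: "'a graph \<Rightarrow> 'a set \<Rightarrow> 'a graph \<Rightarrow> bool" where
  "attach_edges G A H \<longleftrightarrow>
     (\<exists>(r::nat) x y a.
        inj_on x {..<r} \<and> inj_on y {..<r} \<and> x ` {..<r} \<inter> y ` {..<r} = {} \<and>
        (x ` {..<r} \<union> y ` {..<r}) \<inter> verts G = {} \<and>
        a ` {..<r} \<subseteq> A \<and>
        H = Graph (verts G \<union> x ` {..<r} \<union> y ` {..<r})
              (edges G \<union> {{x i, y i} | i. i < r} \<union> {{x i, a i} | i. i < r}))"

end

theory Submission
  imports Defs
begin

text \<open>An isolating set of the middle graph may be taken to consist of edges, and a set of edges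
  is isolating iff it meets every edge; hence the hypothesis says that every edge dominating set
  has at least \<open>k = (n - 1) div 2\<close> elements. Let \<open>A\<close>, \<open>B\<close> be the colour classes of the tree with
  \<open>|A| \<le> |B|\<close>. Choosing one edge at each vertex of \<open>A\<close> gives \<open>k \<le> |A|\<close>, so \<open>(|A|, |B|)\<close> is
  \<open>(k, k + 1)\<close>, \<open>(k, k + 2)\<close> or \<open>(k + 1, k + 1)\<close>. A vertex of \<open>A\<close> can be dropped from this choice
  when all its neighbours are ends of the edges chosen at other vertices. If \<open>|A| = k\<close>, no vertex
  can be dropped, so every vertex of \<open>A\<close> has a leaf neighbour, and counting edges shows that all
  degrees in \<open>A\<close> are 2, up to a single 3. If \<open>|A| = |B| = k + 1\<close>, no two vertices of the same
  class can be dropped together. Then either some class has exactly one leaf and otherwise only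
  vertices of degree 2, or in each class all leaves are at distance two from one common hub. In
  every case the absence of 4-cycles and 6-cycles makes the required choices of edges
  independent of each other, and the tree can be read off.\<close>

section \<open>Trees and edge domination\<close>

text \<open>The hypothesis enters through one inequality: the vertices \<open>Inr f\<close> with
  \<open>f\<close> in an edge dominating set \<open>F\<close> form an isolating set, so
  \<open>k \<le> card F\<close>. The sum of the degrees over A is |A| + |B| - 1, which is why the
  sizes control the degrees: for (k, k + 1) the average over A is exactly 2, for (k, k + 2) the sum
  exceeds 2|A| by one, and for (k + 1, k + 1) it is one below 2|A|, so that each class contains a
  leaf. Leaves are the cheapest vertices to drop, since only one neighbour has to be covered again;
  dropping a leaf together with a second vertex q restricts the surroundings of q. The obstacle is
  that the edges covering the neighbours of dropped vertices must be chosen at different vertices of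
  A. If one vertex serves two neighbours of the same dropped vertex, a 4-cycle arises. Clashes
  between neighbours of different dropped vertices are not excluded in this way, and in the balanced
  case they give rise to the hubs.\<close>

abbreviation nbrs :: "'a graph \<Rightarrow> 'a \<Rightarrow> 'a set" where
  "nbrs G v \<equiv> {u. adj G v u}"

lemma adj_sym: "adj G u v \<longleftrightarrow> adj G v u"
  by (simp add: adj_def insert_commute)

lemma simple_graph_adjD:
  assumes "simple_graph G" "adj G u v"
  shows "u \<in> verts G" "v \<in> verts G" "u \<noteq> v"
  using assms by (auto simp: simple_graph_def adj_def)

lemma simple_graph_edgeE:
  assumes "simple_graph G" "e \<in> edges G"
  obtains u v where "e = {u, v}" "u \<noteq> v" "adj G u v"
proof -
  have "card e = 2" using assms by (auto simp: simple_graph_def)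
  then obtain u v where "e = {u, v}" "u \<noteq> v" by (auto simp: card_2_iff)
  with assms that show ?thesis by (auto simp: adj_def)
qed

lemma finite_edges: "simple_graph G \<Longrightarrow> finite (edges G)"
  by (rule finite_subset[of _ "Pow (verts G)"]) (auto simp: simple_graph_def)

lemma connected_closed_subset:
  assumes "connected G" "u \<in> S" "u \<in> verts G"
    and closed: "\<And>x y. x \<in> S \<Longrightarrow> adj G x y \<Longrightarrow> y \<in> S"
  shows "verts G \<subseteq> S"
proof
  fix v assume "v \<in> verts G"
  then have "\<exists>p. walk G u p v" using assms by (auto simp: connected_def)
  then obtain p where p: "walk G u p v" ..
  have "last q \<in> S" if "q \<noteq> []" "hd q \<in> S" "successively (adj G) q" for q
    using that
  proof (induction q)
    case (Cons x q)
    then show ?case using closed by (cases q) auto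
  qed simp
  then show "v \<in> S" using p assms(2) by (auto simp: walk_def)
qed

lemma walk_snoc:
  "walk G u p v \<Longrightarrow> adj G v w \<Longrightarrow> w \<in> verts G \<Longrightarrow> walk G u (p @ [w]) w"
  by (auto simp: walk_def successively_append_iff)

lemma walk_rev: "walk G u p v \<Longrightarrow> walk G v (rev p) u"
  by (auto simp: walk_def hd_rev last_rev adj_sym[of G] elim: successively_mono)

text \<open>A vertex v outside S that is adjacent to u in S has no second neighbour w in S: a
  repetition-free walk from u to w inside S, extended by v, would be a cycle. Hence one step adds
  exactly one edge, and v can receive the colour opposite to that of u. The walks inside S are part
  of the induction claim for this reason.\<close>

lemma tree_grow:
  assumes T: "tree T" and m: "1 \<le> m" "m \<le> card (verts T)"
  shows "\<exists>S (c :: 'a \<Rightarrow> bool). S \<subseteq> verts T \<and> card S = m \<and>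
    (\<forall>x\<in>S. \<forall>y\<in>S. \<exists>p. walk T x p y \<and> set p \<subseteq> S \<and> distinct p) \<and>
    card {e \<in> edges T. e \<subseteq> S} + 1 = m \<and>
    (\<forall>x\<in>S. \<forall>y\<in>S. adj T x y \<longrightarrow> c x \<noteq> c y)"
  using m
proof (induction m rule: nat_induct_at_least)
  case base
  have sg: "simple_graph T" using T by (simp add: tree_def)
  obtain r where r: "r \<in> verts T" using T by (auto simp: tree_def connected_def)
  have "{e \<in> edges T. e \<subseteq> {r}} = {}"
    using simple_graph_edgeE[OF sg] by (metis (no_types, lifting) Collect_empty_eq insert_subset singletonD)
  moreover have "\<not> adj T r r" using simple_graph_adjD[OF sg] by blast
  ultimately show ?case using r
    by (intro exI[of _ "{r}"] exI[of _ "\<lambda>_. True"])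
      (auto intro!: exI[of _ "[r]"] simp: walk_def)
next
  case (Suc m)
  have sg: "simple_graph T" and cn: "connected T" and ac: "\<And>p. \<not> cycle T p"
    using T by (auto simp: tree_def)
  have finV: "finite (verts T)" using sg by (simp add: simple_graph_def)
  have "m \<le> card (verts T)" using Suc.prems by simp
  from Suc.IH[OF this] obtain S and c :: "'a \<Rightarrow> bool" where S: "S \<subseteq> verts T" "card S = m"
    and paths: "\<forall>x\<in>S. \<forall>y\<in>S. \<exists>p. walk T x p y \<and> set p \<subseteq> S \<and> distinct p"
    and ce: "card {e \<in> edges T. e \<subseteq> S} + 1 = m"
    and col: "\<forall>x\<in>S. \<forall>y\<in>S. adj T x y \<longrightarrow> c x \<noteq> c y"
    by (elim exE conjE)
  have finS: "finite S" by (rule finite_subset[OF S(1) finV])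
  have "S \<noteq> {}" using S Suc.hyps by auto
  then obtain r where "r \<in> S" by blast
  moreover have "\<not> verts T \<subseteq> S" using S Suc.prems card_mono[OF finS, of "verts T"] by linarith
  ultimately obtain u v where uv: "u \<in> S" "adj T u v" "v \<notin> S"
    using connected_closed_subset[OF cn, of r S] S by blast
  have vV: "v \<in> verts T" using simple_graph_adjD[OF sg uv(2)] by simp
  have uniq: "w = u" if w: "w \<in> S" "adj T w v" for w
  proof (rule ccontr)
    assume "w \<noteq> u"
    obtain p where p: "walk T u p w" "set p \<subseteq> S" "distinct p" using paths uv(1) w(1) by blast
    have "length p \<ge> 2" using p(1) \<open>w \<noteq> u\<close>
      by (cases p; cases "tl p") (auto simp: walk_def)
    moreover have "hd (p @ [v]) = u" using p(1) by (auto simp: walk_def)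
    ultimately have "cycle T (p @ [v])"
      using walk_snoc[OF p(1) w(2) vV] p uv by (auto simp: cycle_def adj_sym[of T v u])
    with ac show False by blast
  qed
  have E: "{e \<in> edges T. e \<subseteq> insert v S} = insert {u, v} {e \<in> edges T. e \<subseteq> S}" (is "?L = ?R")
  proof
    show "?L \<subseteq> ?R"
    proof
      fix e assume e: "e \<in> ?L"
      then obtain x y where xy: "e = {x, y}" "x \<noteq> y" "adj T x y"
        using simple_graph_edgeE[OF sg] by blast
      show "e \<in> ?R"
      proof (cases "v \<in> e")
        case True
        then show ?thesis using e xy uniq[of x] uniq[of y] adj_sym[of T x y] by auto
      next
        case False then show ?thesis using e by auto
      qed
    qed
    show "?R \<subseteq> ?L" using uv by (auto simp: adj_def)
  qed
  have "card {e \<in> edges T. e \<subseteq> insert v S} = Suc (card {e \<in> edges T. e \<subseteq> S})"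
    unfolding E using finite_edges[OF sg] uv by (subst card_insert_disjoint) auto
  moreover have "\<exists>p. walk T x p y \<and> set p \<subseteq> insert v S \<and> distinct p"
    if "x \<in> insert v S" "y \<in> insert v S" for x y
  proof -
    have to_v: "\<exists>p. walk T x p v \<and> set p \<subseteq> insert v S \<and> distinct p" if x: "x \<in> S" for x
    proof -
      obtain p where "walk T x p u" "set p \<subseteq> S" "distinct p" using paths x uv(1) by blast
      then show ?thesis using walk_snoc[OF _ uv(2) vV] uv by (intro exI[of _ "p @ [v]"]) auto
    qed
    consider "x \<in> S" "y \<in> S" | "x \<in> S" "y = v" | "x = v" "y \<in> S" | "x = v" "y = v"
      using \<open>x \<in> insert v S\<close> \<open>y \<in> insert v S\<close> by blast
    then show ?thesis
    proof cases
      case 1 then show ?thesis using paths by blast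
    next
      case 2 then show ?thesis using to_v by blast
    next
      case 3 then show ?thesis using to_v[of y] walk_rev by (metis distinct_rev set_rev)
    next
      case 4 then show ?thesis using vV by (intro exI[of _ "[v]"]) (auto simp: walk_def)
    qed
  qed
  moreover have "(c(v := \<not> c u)) x \<noteq> (c(v := \<not> c u)) y"
    if "x \<in> insert v S" "y \<in> insert v S" "adj T x y" for x y
    using that col uniq[of x] uniq[of y] uv simple_graph_adjD(3)[OF sg, of x y] adj_sym[of T x y]
    by auto
  ultimately show ?case using S vV uv finS ce
    by (intro exI[of _ "insert v S"] exI[of _ "c(v := \<not> c u)"]) auto
qed

text \<open>Take \<open>m = card (verts T)\<close> in \<open>tree_grow\<close>: the subset is then
  all of \<open>verts T\<close>.\<close>

lemma tree_bipartite_card_edges: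
  assumes "tree T"
  obtains A B where "A \<inter> B = {}" "verts T = A \<union> B"
    "edges T \<subseteq> {{a, b} | a b. a \<in> A \<and> b \<in> B}"
    "card (edges T) + 1 = card (verts T)"
proof -
  have sg: "simple_graph T" and ne: "verts T \<noteq> {}"
    using assms by (auto simp: tree_def connected_def)
  have fin: "finite (verts T)" using sg by (simp add: simple_graph_def)
  have "1 \<le> card (verts T)" using fin ne by (simp add: Suc_le_eq card_gt_0_iff)
  from tree_grow[OF assms this order_refl] obtain S and c :: "'a \<Rightarrow> bool"
    where S: "S \<subseteq> verts T" "card S = card (verts T)"
      and ce: "card {e \<in> edges T. e \<subseteq> S} + 1 = card (verts T)"
      and col: "\<forall>x\<in>S. \<forall>y\<in>S. adj T x y \<longrightarrow> c x \<noteq> c y"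
    by (elim exE conjE)
  have SV: "S = verts T" using S fin by (simp add: card_subset_eq)
  have 1: "{v \<in> verts T. c v} \<inter> {v \<in> verts T. \<not> c v} = {}" by blast
  have 2: "verts T = {v \<in> verts T. c v} \<union> {v \<in> verts T. \<not> c v}" by blast
  have 3: "edges T \<subseteq> {{a, b} | a b. a \<in> {v \<in> verts T. c v} \<and> b \<in> {v \<in> verts T. \<not> c v}}"
  proof
    fix e assume "e \<in> edges T"
    then obtain x y where xy: "e = {x, y}" "adj T x y" using simple_graph_edgeE[OF sg] by blast
    then have "x \<in> verts T" "y \<in> verts T" "c x \<noteq> c y"
      using simple_graph_adjD[OF sg xy(2)] col SV by auto
    then show "e \<in> {{a, b} | a b. a \<in> {v \<in> verts T. c v} \<and> b \<in> {v \<in> verts T. \<not> c v}}"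
      using xy(1) insert_commute[of x y "{}"] by (cases "c x") blast+
  qed
  have "{e \<in> edges T. e \<subseteq> S} = edges T" using sg SV by (auto simp: simple_graph_def)
  with ce have "card (edges T) + 1 = card (verts T)" by simp
  from that[OF 1 2 3 this] show ?thesis .
qed

text \<open>Each \<open>Inr e\<close> is selected or adjacent to a selected \<open>Inr f\<close>, so
  only vertices of the form \<open>Inl v\<close> can stay undominated, and these are pairwise
  nonadjacent in the middle graph.\<close>

lemma isolation_number_middle_graph_le:
  assumes sg: "simple_graph T" and F: "F \<subseteq> edges T"
    and dom: "\<And>e. e \<in> edges T \<Longrightarrow> \<exists>f\<in>F. e \<inter> f \<noteq> {}"
  shows "isolation_number (middle_graph T) \<le> card F"
proof -
  let ?M = "middle_graph T"
  have vM: "verts ?M = Inl ` verts T \<union> Inr ` edges T" by (simp add: middle_graph_def)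
  have finM: "finite (verts ?M)"
    using sg finite_edges[OF sg] by (simp add: vM simple_graph_def)
  have fin: "finite {card S | S. isolating_set ?M S}"
  proof (rule finite_subset)
    show "{card S | S. isolating_set ?M S} \<subseteq> card ` Pow (verts ?M)"
      by (auto simp: isolating_set_def)
  qed (use finM in auto)
  have dominated: "Inr e \<in> closed_nbhd ?M (Inr ` F)" if e: "e \<in> edges T" for e
  proof -
    obtain f where f: "f \<in> F" "e \<inter> f \<noteq> {}" using dom[OF e] by blast
    show ?thesis
    proof (cases "f = e")
      case False
      have "adj ?M (Inr f) (Inr e)"
        using f F e False unfolding adj_def middle_graph_def by auto
      then show ?thesis using f e by (auto simp: closed_nbhd_def vM)
    qed (use f in \<open>auto simp: closed_nbhd_def\<close>)
  qed
  have "isolating_set ?M (Inr ` F)"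
    unfolding isolating_set_def independent_set_def
  proof (intro conjI ballI notI)
    fix u v
    assume u: "u \<in> verts ?M - closed_nbhd ?M (Inr ` F)"
      and v: "v \<in> verts ?M - closed_nbhd ?M (Inr ` F)" and "adj ?M u v"
    then have "{u, v} \<inter> range Inr \<noteq> {}" by (auto simp: adj_def middle_graph_def doubleton_eq_iff)
    then obtain e where "Inr e = u \<or> Inr e = v" by auto
    then show False using u v dominated by (auto simp: vM)
  qed (use F in \<open>auto simp: vM\<close>)
  then have "card (Inr ` F :: ('a + 'a set) set) \<in> {card S | S. isolating_set ?M S}" by blast
  then have "isolation_number ?M \<le> card (Inr ` F :: ('a + 'a set) set)"
    unfolding isolation_number_def using fin by (simp add: Min_le)
  then show ?thesis by (simp add: card_image)
qed

section \<open>Attached edges, spiders and diameters\<close>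

text \<open>The set \<open>X\<close> of inner vertices takes the place of the index range: leaf and
  attachment point become functions \<open>y\<close> and \<open>a\<close> of the inner vertex. An
  enumeration of the finite set \<open>X\<close> gives the numbering back.\<close>

lemma attach_edgesI:
  assumes fin: "finite X" and inj: "inj_on y X"
    and disj: "X \<inter> y ` X = {}" "(X \<union> y ` X) \<inter> verts G = {}" and a: "a ` X \<subseteq> At"
    and H: "verts H = verts G \<union> X \<union> y ` X"
      "edges H = edges G \<union> {{x, y x} | x. x \<in> X} \<union> {{x, a x} | x. x \<in> X}"
  shows "attach_edges G At H"
proof -
  obtain h where h: "bij_betw h {0..<card X} X" using ex_bij_betw_nat_finite[OF fin] ..
  then have injh: "inj_on h {..<card X}" and X: "X = h ` {..<card X}"
    by (auto simp: bij_betw_def atLeast0LessThan)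
  have "inj_on (y \<circ> h) {..<card X}" using inj X by (intro comp_inj_on injh) simp
  moreover have "y ` X = (y \<circ> h) ` {..<card X}" using X by (metis image_comp)
  moreover have "a ` X = (a \<circ> h) ` {..<card X}" using X by (metis image_comp)
  moreover have "{{x, g x} | x. x \<in> X} = {{h i, (g \<circ> h) i} | i. i < card X}" for g :: "'a \<Rightarrow> 'a"
    using X by (auto 0 4)
  moreover have "H = Graph (verts H) (edges H)" by simp
  ultimately show ?thesis unfolding attach_edges_def using disj a H X injh
    by (intro exI[of _ "card X"] exI[of _ h] exI[of _ "y \<circ> h"] exI[of _ "a \<circ> h"])
      (metis (no_types, lifting))
qed

lemma attach_edgesE:
  assumes "attach_edges G At H"
  obtains X y a where "finite X" "inj_on y X" "X \<inter> y ` X = {}"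
    "(X \<union> y ` X) \<inter> verts G = {}" "a ` X \<subseteq> At" "verts H = verts G \<union> X \<union> y ` X"
    "edges H = edges G \<union> {{x, y x} | x. x \<in> X} \<union> {{x, a x} | x. x \<in> X}"
proof -
  obtain r :: nat and x y a where inj: "inj_on x {..<r}" "inj_on y {..<r}"
    and disj: "x ` {..<r} \<inter> y ` {..<r} = {}" "(x ` {..<r} \<union> y ` {..<r}) \<inter> verts G = {}"
    and a: "a ` {..<r} \<subseteq> At"
    and H: "H = Graph (verts G \<union> x ` {..<r} \<union> y ` {..<r})
      (edges G \<union> {{x i, y i} | i. i < r} \<union> {{x i, a i} | i. i < r})"
    using assms unfolding attach_edges_def by (elim exE conjE)
  define j where "j = inv_into {..<r} x"
  have j: "j (x i) = i" if "i < r" for i using inj(1) that by (simp add: j_def)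
  have jx: "(g \<circ> j) ` x ` {..<r} = g ` {..<r}" for g :: "nat \<Rightarrow> 'a"
    using j by (auto simp: image_iff)
  have edge: "{{v, (g \<circ> j) v} | v. v \<in> x ` {..<r}} = {{x i, g i} | i. i < r}" for g :: "nat \<Rightarrow> 'a"
    using j by auto
  have injy: "inj_on (y \<circ> j) (x ` {..<r})"
    using inj j by (auto simp: inj_on_def)
  show ?thesis
    by (rule that[of "x ` {..<r}" "y \<circ> j" "a \<circ> j"])
      (use injy disj a H in \<open>simp_all only: jx edge graph.sel finite_imageI finite_lessThan\<close>)
qed

text \<open>Since \<open>w\<close> lies in the base but outside \<open>At\<close>, no attached edge
  meets it. This allows the extra leaf to be kept in the core and removed at the end.\<close>

lemma attach_edges_delete_vertex:
  assumes "attach_edges G At H" "w \<in> verts G" "w \<notin> At"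
  shows "attach_edges (delete_vertex G w) At (delete_vertex H w)"
  using assms(1)
proof (rule attach_edgesE)
  fix X y a
  assume X: "finite X" "inj_on y X" "X \<inter> y ` X = {}"
    "(X \<union> y ` X) \<inter> verts G = {}" "a ` X \<subseteq> At" "verts H = verts G \<union> X \<union> y ` X"
    "edges H = edges G \<union> {{x, y x} | x. x \<in> X} \<union> {{x, a x} | x. x \<in> X}"
  have "{e \<in> edges H. w \<notin> e} =
    {e \<in> edges G. w \<notin> e} \<union> {{x, y x} | x. x \<in> X} \<union> {{x, a x} | x. x \<in> X}"
    using X(4,5) assms(2,3) unfolding X(7) by auto
  moreover have "verts H - {w} = verts G - {w} \<union> X \<union> y ` X"
    using X(4) assms(2) unfolding X(6) by auto
  moreover have "(X \<union> y ` X) \<inter> (verts G - {w}) = {}" using X(4) by blast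
  ultimately show ?thesis
    using X(1-3,5) by (intro attach_edgesI[of X y]) (simp_all add: delete_vertex_def)
qed

text \<open>The leg c, p, q of the base itself has the form of an attached edge, with inner vertex p
  and leaf q, so p can be moved into the set \<open>X\<close>.\<close>

lemma attach_edges_shrink_base:
  assumes "attach_edges (Graph {c, p, q} {{p, q}, {p, c}}) {c} H" "distinct [c, p, q]"
  shows "attach_edges (Graph {c} {}) {c} H"
  using assms(1)
proof (rule attach_edgesE)
  fix X y a
  assume X: "finite X" "inj_on y X" "X \<inter> y ` X = {}"
    "(X \<union> y ` X) \<inter> verts (Graph {c, p, q} {{p, q}, {p, c}}) = {}" "a ` X \<subseteq> {c}"
    "verts H = verts (Graph {c, p, q} {{p, q}, {p, c}}) \<union> X \<union> y ` X"
    "edges H = edges (Graph {c, p, q} {{p, q}, {p, c}}) \<union> {{x, y x} | x. x \<in> X} \<union> {{x, a x} | x. x \<in> X}"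
  let ?y = "y(p := q)" and ?a = "a(p := c)"
  have pX: "p \<notin> X" "q \<notin> X" "p \<notin> y ` X" "q \<notin> y ` X" "c \<notin> X" "c \<notin> y ` X" using X(4) by auto
  have upd: "f(p := z) ` X = f ` X" for f :: "'a \<Rightarrow> 'a" and z using pX(1) by auto
  have E: "{{x, (f(p := z)) x} | x. x \<in> insert p X} = insert {p, z} {{x, f x} | x. x \<in> X}"
    for f :: "'a \<Rightarrow> 'a" and z using pX(1) by auto
  show ?thesis
  proof (rule attach_edgesI[of "insert p X" ?y _ ?a])
    show "inj_on ?y (insert p X)" using X(2) pX by (auto simp: inj_on_def)
    show "edges H = edges (Graph {c} {}) \<union> {{x, ?y x} | x. x \<in> insert p X} \<union>
        {{x, ?a x} | x. x \<in> insert p X}"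
      unfolding E X(7) by auto
  qed (use X pX assms(2) upd in auto)
qed

section \<open>Isomorphisms with spiders, paths and stars\<close>

lemma spider_eq:
  "spider r = Graph ({Inl 0} \<union> (\<lambda>i. Inl (Suc i)) ` {..<r} \<union> (\<lambda>i. Inr {0, Suc i}) ` {..<r})
    ({{Inr {0, Suc i}, Inl (Suc i)} | i. i < r} \<union> {{Inr {0, Suc i}, Inl 0} | i. i < r})"
proof -
  have 1: "{1..r} = Suc ` {..<r}" by (simp add: image_Suc_lessThan)
  have 2: "{0..r} = insert 0 (Suc ` {..<r})" by (auto simp: image_Suc_lessThan)
  have 3: "edges (star_graph r) = (\<lambda>i. {0, Suc i}) ` {..<r}" unfolding star_graph_def 1 by auto
  have V: "verts (star_graph r) = insert 0 (Suc ` {..<r})" by (simp add: star_graph_def 2)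
  show ?thesis unfolding spider_def subdivide_edges_def 3 V
    by (auto simp: insert_commute image_iff)
qed

lemma graph_isoI:
  assumes bij: "bij_betw f (verts G) (verts H)"
    and edgef: "(`) f ` edges G = edges H" and sub: "\<And>e. e \<in> edges G \<Longrightarrow> e \<subseteq> verts G"
  shows "graph_iso G H"
proof -
  have injf: "inj_on f (verts G)" using bij by (simp add: bij_betw_def)
  have "adj G u v \<longleftrightarrow> adj H (f u) (f v)" if "u \<in> verts G" "v \<in> verts G" for u v
  proof
    assume "adj G u v"
    then have "f ` {u, v} \<in> (`) f ` edges G" by (simp add: adj_def del: image_insert)
    then show "adj H (f u) (f v)" by (simp add: edgef adj_def)
  next
    assume "adj H (f u) (f v)"
    then have "f ` {u, v} \<in> (`) f ` edges G" by (simp add: edgef adj_def)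
    then obtain e where e: "e \<in> edges G" "f ` {u, v} = f ` e" by auto
    have "{u, v} = e"
      using e sub that inj_on_image_eq_iff[OF injf, of "{u, v}" e] by simp
    then show "adj G u v" using e(1) by (simp add: adj_def)
  qed
  then show ?thesis unfolding graph_iso_def using bij by blast
qed

lemma attach_edges_star_spider:
  assumes "attach_edges (Graph {c} {}) {c} H"
  obtains r where "graph_iso H (spider r)" "card (verts H) = 2 * r + 1"
proof -
  obtain r :: nat and x y a where inj: "inj_on x {..<r}" "inj_on y {..<r}"
    and disj: "x ` {..<r} \<inter> y ` {..<r} = {}" "(x ` {..<r} \<union> y ` {..<r}) \<inter> {c} = {}"
    and a: "a ` {..<r} \<subseteq> {c}"
    and H: "H = Graph ({c} \<union> x ` {..<r} \<union> y ` {..<r})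
      ({} \<union> {{x i, y i} | i. i < r} \<union> {{x i, a i} | i. i < r})"
    using assms unfolding attach_edges_def graph.sel by (elim exE conjE)
  have ac: "a i = c" if "i < r" for i using a that by auto
  have V: "verts H = {c} \<union> y ` {..<r} \<union> x ` {..<r}" using H by auto
  have E: "edges H = {{x i, y i} | i. i < r} \<union> {{x i, c} | i. i < r}"
    using H ac by auto
  \<comment> \<open>Follows the shape of \<open>spider_eq\<close>: the centre goes to 0, the inner
    vertex \<open>x i\<close> to the subdivision vertex of the edge \<open>{0, Suc i}\<close>, the
    leaf \<open>y i\<close> to the star leaf \<open>Suc i\<close>. The shift by one leaves 0 for the
    centre.\<close>
  define f where "f v = (if v = c then Inl 0 else if v \<in> x ` {..<r}
    then Inr {0, Suc (inv_into {..<r} x v)} else Inl (Suc (inv_into {..<r} y v)))" for v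
  have fc: "f c = Inl 0" by (simp add: f_def)
  have fx: "f (x i) = Inr {0, Suc i}" if "i < r" for i
    using that inj(1) disj by (auto simp: f_def)
  have fy: "f (y i) = Inl (Suc i)" if "i < r" for i
    using that inj(2) disj by (auto simp: f_def)
  have img: "f ` verts H = verts (spider r)"
  proof -
    have "f ` x ` {..<r} = (\<lambda>i. Inr {0, Suc i}) ` {..<r}"
      unfolding image_image using fx by (intro image_cong) auto
    moreover have "f ` y ` {..<r} = (\<lambda>i. Inl (Suc i)) ` {..<r}"
      unfolding image_image using fy by (intro image_cong) auto
    ultimately show ?thesis by (simp add: V spider_eq image_Un fc)
  qed
  have injf: "inj_on f (verts H)"
    by (rule inj_onI) (auto simp: V fc fx fy doubleton_eq_iff)
  have collect: "{g i | i. i < r} = g ` {..<r}" for g :: "nat \<Rightarrow> 'a set"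
    by auto
  have collect': "{g i | i. i < r} = g ` {..<r}" for g :: "nat \<Rightarrow> (nat + nat set) set"
    by auto
  have "(`) f ` edges H = edges (spider r)"
    unfolding E spider_eq graph.sel collect collect' image_Un image_image
    by (intro arg_cong2[where f = "(\<union>)"] image_cong) (simp_all add: fc fx fy)
  then have "graph_iso H (spider r)"
    using img injf by (intro graph_isoI[of f]) (auto simp: bij_betw_def E V)
  moreover have "card (verts H) = 2 * r + 1"
  proof -
    have "card (x ` {..<r} \<union> y ` {..<r}) = r + r"
      using inj disj by (simp add: card_Un_disjoint card_image)
    moreover have "verts H = insert c (x ` {..<r} \<union> y ` {..<r})" using V by auto
    ultimately show ?thesis using disj by auto
  qed
  ultimately show ?thesis by (rule that)
qed

lemma edges_path_on_Cons_Cons: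
  "edges (path_on (a # b # us)) = insert {a, b} (edges (path_on (b # us)))"
proof -
  have eq: "(\<exists>i. e = {(a # b # us) ! i, (a # b # us) ! Suc i} \<and> Suc i < length (a # b # us)) \<longleftrightarrow>
    e = {a, b} \<or> (\<exists>i. e = {(b # us) ! i, (b # us) ! Suc i} \<and> Suc i < length (b # us))"
    (is "?L \<longleftrightarrow> ?R") for e
  proof
    assume ?L
    then obtain i where "e = {(a # b # us) ! i, (a # b # us) ! Suc i}" "Suc i < length (a # b # us)"
      by blast
    then show ?R by (cases i) auto
  next
    assume ?R
    then show ?L
    proof
      assume "e = {a, b}" then show ?L by (intro exI[of _ 0]) simp
    next
      assume "\<exists>i. e = {(b # us) ! i, (b # us) ! Suc i} \<and> Suc i < length (b # us)"
      then obtain i where "e = {(b # us) ! i, (b # us) ! Suc i}" "Suc i < length (b # us)" by blast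
      then show ?L by (intro exI[of _ "Suc i"]) simp
    qed
  qed
  show ?thesis by (rule set_eqI) (simp only: mem_Collect_eq insert_iff path_on_def graph.sel eq)
qed

lemma edges_path_on_single: "edges (path_on [a]) = {}"
  by (simp add: path_on_def)

lemma verts_path_on: "verts (path_on us) = set us"
  by (simp add: path_on_def)

lemma graph_iso_path_on:
  assumes "distinct us"
  shows "graph_iso (path_on us) (path_graph (length us))"
proof -
  have adj_nth: "adj (path_on vs) (vs ! i) (vs ! j) \<longleftrightarrow> j = Suc i \<or> i = Suc j"
    if "distinct vs" "i < length vs" "j < length vs" for vs :: "'b list" and i j
  proof -
    have eq: "vs ! i' = vs ! j' \<longleftrightarrow> i' = j'" if "i' < length vs" "j' < length vs" for i' j'
      using \<open>distinct vs\<close> that by (simp add: nth_eq_iff_index_eq)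
    show ?thesis using that(2,3) by (auto simp: adj_def path_on_def doubleton_eq_iff eq)
  qed
  let ?f = "inv_into {..<length us} ((!) us)"
  have bij: "bij_betw ((!) us) {..<length us} (set us)"
    using assms by (intro bij_betw_nth) auto
  have f: "?f v < length us" "us ! ?f v = v" if "v \<in> set us" for v
    using bij_betw_inv_into_right[OF bij that] bij_betwE[OF bij_betw_inv_into[OF bij]] that by auto
  have "adj (path_on us) u v \<longleftrightarrow> adj (path_graph (length us)) (?f u) (?f v)"
    if "u \<in> set us" "v \<in> set us" for u v
    using adj_nth[OF assms f(1)[OF that(1)] f(1)[OF that(2)]] f[OF that(1)] f[OF that(2)]
      adj_nth[of "[0..<length us]" "?f u" "?f v"]
    by (simp add: path_graph_def)
  moreover have "bij_betw ?f (set us) {..<length us}" by (rule bij_betw_inv_into[OF bij])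
  ultimately show ?thesis
    unfolding graph_iso_def path_graph_def
    by (intro exI[of _ ?f]) (simp add: verts_path_on atLeast0LessThan)
qed

lemma graph_iso_star:
  assumes "verts G = insert c L" "c \<notin> L" "finite L" "edges G = {{c, l} | l. l \<in> L}"
  shows "graph_iso G (star_graph (card L))"
proof -
  obtain h where h: "bij_betw h L {1..card L}"
    using finite_same_card_bij[OF assms(3), of "{1..card L}"] by auto
  let ?f = "\<lambda>v. if v = c then 0 else h v"
  have hL: "h l \<in> {1..card L}" if "l \<in> L" for l using bij_betwE[OF h] that by blast
  have inj: "inj_on ?f (insert c L)"
    using h hL assms(2) by (fastforce simp: inj_on_def bij_betw_def)
  have "?f ` L = h ` L" using assms(2) by (intro image_cong) auto
  then have "?f ` insert c L = insert 0 {1..card L}" using h unfolding bij_betw_def image_insert by simp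
  also have "\<dots> = {0..card L}" by auto
  finally have bij: "bij_betw ?f (verts G) (verts (star_graph (card L)))"
    using inj by (simp add: bij_betw_def assms(1) star_graph_def)
  have "edges (star_graph (card L)) = (\<lambda>i. {0, i}) ` h ` L"
    using h unfolding bij_betw_def star_graph_def by auto
  moreover have "edges G = (\<lambda>l. {c, l}) ` L" unfolding assms(4) by auto
  ultimately have "(`) ?f ` edges G = edges (star_graph (card L))"
    using assms(2) by (auto simp: image_image intro!: image_cong)
  then show ?thesis using bij by (rule_tac graph_isoI[of ?f]) (auto simp: assms(1,4))
qed

section \<open>Bounds for distances and the diameter\<close>

lemma finite_dist_set:
  assumes "finite (verts G)"
  shows "finite {dist G u v | u v. u \<in> verts G \<and> v \<in> verts G}"
proof -
  have "{dist G u v | u v. u \<in> verts G \<and> v \<in> verts G} = (\<lambda>(u, v). dist G u v) ` (verts G \<times> verts G)"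
    by auto
  then show ?thesis using assms by simp
qed

lemma diam_le_4:
  assumes fin: "finite (verts G)" and c: "c \<in> verts G"
    and near: "\<And>v. v \<in> verts G \<Longrightarrow> v = c \<or> adj G v c \<or> (\<exists>w\<in>verts G. adj G v w \<and> adj G w c)"
  shows "diam G \<le> 4"
proof -
  have walk_c: "\<exists>p. walk G v p c \<and> length p \<le> 3" if v: "v \<in> verts G" for v
    using near[OF v]
  proof (elim disjE bexE conjE)
    assume "v = c"
    then show ?thesis using c by (intro exI[of _ "[c]"]) (auto simp: walk_def)
  next
    assume "adj G v c"
    then show ?thesis using c v by (intro exI[of _ "[v, c]"]) (auto simp: walk_def)
  next
    fix w assume "w \<in> verts G" "adj G v w" "adj G w c"
    then show ?thesis using c v by (intro exI[of _ "[v, w, c]"]) (auto simp: walk_def)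
  qed
  have "dist G u v \<le> 4" if uv: "u \<in> verts G" "v \<in> verts G" for u v
  proof -
    obtain p where p: "walk G u p c" "length p \<le> 3" using walk_c[OF uv(1)] by blast
    obtain q where "walk G v q c" "length q \<le> 3" using walk_c[OF uv(2)] by blast
    then have q: "walk G c (rev q) v" "length (rev q) \<le> 3" using walk_rev by auto
    \<comment> \<open>\<open>p\<close> already ends in \<open>c\<close>, so the head of the second
      walk is dropped: at most 3 + 2 vertices remain, that is 4 edges.\<close>
    obtain q' where q': "rev q = c # q'" using q(1) by (cases "rev q") (auto simp: walk_def)
    have w: "walk G u (p @ q') v"
      using p(1) q(1) unfolding q'
      by (cases q') (auto simp: walk_def successively_append_iff)
    have "dist G u v \<le> length (p @ q') - 1"
      unfolding dist_def using w by (intro Least_le) blast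
    also have "\<dots> \<le> 4" using p(2) q(2) q' by auto
    finally show ?thesis .
  qed
  then show ?thesis unfolding diam_def using c finite_dist_set[OF fin]
    by (subst Max_le_iff) auto
qed

text \<open>A function that grows by at most one along each edge bounds the length of all walks from
  \<open>u\<close> to \<open>v\<close> at once, hence of a shortest one. Since \<open>{x, y}\<close>
  is unordered, the assumption limits the change in both directions.\<close>

lemma diam_ge_of_Lipschitz:
  fixes \<phi> :: "'a \<Rightarrow> nat"
  assumes fin: "finite (verts G)" and conn: "connected G"
    and uv: "u \<in> verts G" "v \<in> verts G"
    and lip: "\<And>x y. {x, y} \<in> edges G \<Longrightarrow> \<phi> y \<le> \<phi> x + 1"
    and d: "\<phi> u + d \<le> \<phi> v"
  shows "d \<le> diam G"
proof -
  have walk_ge: "\<phi> (last p) \<le> \<phi> (hd p) + (length p - 1)" if "p \<noteq> []" "successively (adj G) p" for p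
    using that
  proof (induction p)
    case (Cons x p)
    show ?case
    proof (cases p)
      case (Cons y q)
      then have "\<phi> (last p) \<le> \<phi> y + (length p - 1)" "adj G x y"
        using Cons.IH Cons.prems \<open>p = y # q\<close> by auto
      moreover from this(2) have "\<phi> y \<le> \<phi> x + 1" using lip by (simp add: adj_def)
      ultimately show ?thesis using Cons by simp
    qed simp
  qed simp
  have "\<exists>d p. walk G u p v \<and> length p - 1 = d" using conn uv by (simp add: connected_def)
  then have "\<exists>p. walk G u p v \<and> length p - 1 = dist G u v"
    unfolding dist_def by (rule LeastI_ex)
  then obtain p where p: "walk G u p v" "length p - 1 = dist G u v" by blast
  have "d \<le> dist G u v" using walk_ge[of p] p d by (auto simp: walk_def)
  also have "dist G u v \<le> diam G"
    unfolding diam_def using uv by (intro Max_ge finite_dist_set[OF fin]) blast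
  finally show ?thesis .
qed

lemma attach_edges_diam_ge:
  fixes \<phi> :: "'a \<Rightarrow> nat"
  assumes "attach_edges G At H" and fin: "finite (verts H)" and conn: "connected H"
    and At: "At \<subseteq> verts G" and eG: "\<And>e. e \<in> edges G \<Longrightarrow> e \<subseteq> verts G"
    and uv: "u \<in> verts G" "v \<in> verts G"
    and lip: "\<And>x y. {x, y} \<in> edges G \<Longrightarrow> \<phi> y \<le> \<phi> x + 1"
    and d: "\<phi> u + d \<le> \<phi> v"
  shows "d \<le> diam H"
  using assms(1)
proof (rule attach_edgesE)
  fix X y a
  assume X: "finite X" "inj_on y X" "X \<inter> y ` X = {}"
    "(X \<union> y ` X) \<inter> verts G = {}" "a ` X \<subseteq> At" "verts H = verts G \<union> X \<union> y ` X"
    "edges H = edges G \<union> {{x, y x} | x. x \<in> X} \<union> {{x, a x} | x. x \<in> X}"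
  \<comment> \<open>The function is extended so as to be constant on each attached pair, with the
    value at its attachment point; it does not change along any new edge.\<close>
  define \<psi> where "\<psi> z = (if z \<in> verts G then \<phi> z else if z \<in> X then \<phi> (a z)
    else \<phi> (a (inv_into X y z)))" for z
  have \<psi>G: "\<psi> z = \<phi> z" if "z \<in> verts G" for z using that by (simp add: \<psi>_def)
  have \<psi>X: "\<psi> x = \<phi> (a x)" "\<psi> (y x) = \<phi> (a x)" if "x \<in> X" for x
    using that X(2-4) by (auto simp: \<psi>_def)
  have lip': "\<psi> t \<le> \<psi> s + 1" if st: "{s, t} \<in> edges H" for s t
  proof -
    consider "{s, t} \<in> edges G" | x where "x \<in> X" "{s, t} = {x, y x}" | x where "x \<in> X" "{s, t} = {x, a x}"
      using st unfolding X(7) by blast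
    then show ?thesis
    proof cases
      case 1
      then have "s \<in> verts G" "t \<in> verts G" using eG by auto
      then show ?thesis using lip[OF 1] by (simp add: \<psi>G)
    next
      case 2
      then show ?thesis using \<psi>X[OF 2(1)] by (auto simp: doubleton_eq_iff)
    next
      case 3
      have "a x \<in> verts G" using 3(1) X(5) At by auto
      then show ?thesis using 3 \<psi>X(1)[OF 3(1)] by (auto simp: doubleton_eq_iff \<psi>G)
    qed
  qed
  show ?thesis
    by (rule diam_ge_of_Lipschitz[OF fin conn, of u v \<psi>])
      (use uv lip' d X(6) in \<open>auto simp: \<psi>G\<close>)
qed

lemma path_on_index_Lipschitz:
  assumes "distinct u" "{x, y} \<in> edges (path_on u)"
  defines "\<phi> \<equiv> inv_into {..<length u} ((!) u)"
  shows "\<phi> y \<le> \<phi> x + 1"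
proof -
  obtain i where i: "{x, y} = {u ! i, u ! Suc i}" "Suc i < length u"
    using assms(2) by (auto simp: path_on_def)
  have "inj_on ((!) u) {..<length u}" using assms(1) by (intro inj_on_nth) auto
  then have "\<phi> (u ! j) = j" if "j < length u" for j
    using that by (simp add: \<phi>_def)
  then show ?thesis using i by (auto simp: doubleton_eq_iff)
qed

lemma diam_ge_attach_path:
  assumes "attach_edges (path_on u) At H" "finite (verts H)" "connected H"
    "At \<subseteq> set u" "distinct u" "d < length u"
  shows "d \<le> diam H"
proof -
  let ?\<phi> = "inv_into {..<length u} ((!) u)"
  have "inj_on ((!) u) {..<length u}" using assms(5) by (intro inj_on_nth) auto
  then have \<phi>: "?\<phi> (u ! j) = j" if "j < length u" for j using that by simp
  have "?\<phi> (u ! 0) + d \<le> ?\<phi> (u ! d)" using assms(6) \<phi>[of 0] \<phi>[of d] by linarith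
  moreover have "u ! 0 \<in> set u" using assms(6) by (intro nth_mem) linarith
  ultimately show ?thesis
    using assms path_on_index_Lipschitz[OF assms(5)]
    by (intro attach_edges_diam_ge[OF assms(1-3), of "u ! 0" "u ! d" ?\<phi>])
      (auto simp: verts_path_on path_on_def)
qed

lemma diam_ge_attach_path_leaf:
  assumes "attach_edges (add_leaf (path_on u) (u ! i) v) At H" "finite (verts H)" "connected H"
    "At \<subseteq> set u" "distinct u" "d < length u" "i < length u" "v \<notin> set u"
  shows "d \<le> diam H"
proof -
  let ?\<phi> = "inv_into {..<length u} ((!) u)"
  \<comment> \<open>The extra leaf takes the position \<open>i\<close> of its neighbour, and path
    vertices keep their position on the path.\<close>
  let ?\<psi> = "?\<phi>(v := i)"
  have "inj_on ((!) u) {..<length u}" using assms(5) by (intro inj_on_nth) auto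
  then have \<phi>: "?\<phi> (u ! j) = j" if "j < length u" for j using that by simp
  have ne: "u ! j \<noteq> v" if "j < length u" for j using that assms(8) nth_mem by metis
  have l0: "0 < length u" using assms(6) by linarith
  have "?\<psi> (u ! 0) + d \<le> ?\<psi> (u ! d)"
    using \<phi>[OF l0] \<phi>[OF assms(6)] ne[OF l0] ne[OF assms(6)] by simp
  moreover have "u ! 0 \<in> set u" using l0 by (rule nth_mem)
  moreover have "?\<psi> y \<le> ?\<psi> x + 1"
    if "{x, y} \<in> edges (add_leaf (path_on u) (u ! i) v)" for x y
  proof -
    from that consider "{x, y} = {u ! i, v}" | "{x, y} \<in> edges (path_on u)"
      by (auto simp: add_leaf_def)
    then show ?thesis
    proof cases
      case 1
      then show ?thesis using \<phi>[OF assms(7)] ne[OF assms(7)] by (auto simp: doubleton_eq_iff)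
    next
      case 2
      then have "x \<in> set u" "y \<in> set u" by (auto simp: path_on_def doubleton_eq_iff)
      then show ?thesis using path_on_index_Lipschitz[OF assms(5) 2] assms(8) by auto
    qed
  qed
  moreover have "e \<subseteq> verts (add_leaf (path_on u) (u ! i) v)"
    if "e \<in> edges (add_leaf (path_on u) (u ! i) v)" for e
    using that assms(7) by (auto simp: add_leaf_def path_on_def)
  ultimately show ?thesis
    using assms
    by (intro attach_edges_diam_ge[OF assms(1-3), of "u ! 0" "u ! d" ?\<psi>])
      (auto simp: add_leaf_def verts_path_on)
qed

section \<open>Bipartite trees without small edge dominating sets\<close>

text \<open>By \<open>attach_edges_star_spider\<close>, attaching edges to a single vertex
  \<open>c\<close> produces a spider with centre \<open>c\<close>. The number of legs is left open;
  the order of the tree supplies it later.\<close>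

definition spider_with_leaf :: "'a graph \<Rightarrow> bool" where
  "spider_with_leaf G \<longleftrightarrow>
     (\<exists>w c. leaf G w \<and> attach_edges (Graph {c} {}) {c} (delete_vertex G w))"

definition long_family :: "'a graph \<Rightarrow> bool" where
  "long_family G \<longleftrightarrow>
     (\<exists>u. length u = 6 \<and> distinct u \<and> attach_edges (path_on u) {u ! 2, u ! 3} G) \<or>
     (\<exists>u v. length u = 7 \<and> distinct u \<and> v \<notin> set u \<and>
        attach_edges (add_leaf (path_on u) (u ! 3) v) {u ! 2, u ! 4} G) \<or>
     (\<exists>u. length u = 8 \<and> distinct u \<and> attach_edges (path_on u) {u ! 2, u ! 5} G)"

text \<open>Each family is coupled with its range of diameters. As the two ranges exclude each
  other, the diameter bound in (iii) or (iv) then selects the family.\<close>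

definition extremal_even :: "'a graph \<Rightarrow> bool" where
  "extremal_even G \<longleftrightarrow> spider_with_leaf G \<and> diam G \<le> 4 \<or> long_family G \<and> diam G \<ge> 5"

text \<open>The classes are not ordered by size, so that whatever is proved for \<open>A\<close> is
  available for \<open>B\<close> through \<open>swap\<close>. The assumption
  \<open>dominating_card\<close> is the form in which the isolation number is present.\<close>

locale bipartite_tree =
  fixes T :: "'a graph" and A B :: "'a set" and k :: nat
  assumes tree: "tree T" and disj: "A \<inter> B = {}" and V: "verts T = A \<union> B"
    and edges_bip: "edges T \<subseteq> {{a, b} | a b. a \<in> A \<and> b \<in> B}"
    and card3: "3 \<le> card (verts T)"
    and dominating_card: "\<And>F. F \<subseteq> edges T \<Longrightarrow> (\<And>e. e \<in> edges T \<Longrightarrow> \<exists>f\<in>F. e \<inter> f \<noteq> {}) \<Longrightarrow> k \<le> card F"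
begin

abbreviation N :: "'a \<Rightarrow> 'a set" where "N \<equiv> nbrs T"

lemma swap: "bipartite_tree T B A k"
proof
  show "edges T \<subseteq> {{a, b} | a b. a \<in> B \<and> b \<in> A}"
    using edges_bip by (auto simp: insert_commute) blast
qed (use tree disj V card3 dominating_card in auto)

lemma sg: "simple_graph T" and conn: "connected T"
  using tree by (auto simp: tree_def)

lemma finite_verts: "finite (verts T)" and finA: "finite A" and finB: "finite B"
  using sg V by (auto simp: simple_graph_def)

lemma card_V: "card (verts T) = card A + card B"
  using V disj finA finB by (simp add: card_Un_disjoint)

lemma adjD: "adj T u v \<Longrightarrow> u \<in> A \<and> v \<in> B \<or> u \<in> B \<and> v \<in> A"
  using edges_bip by (fastforce simp: adj_def doubleton_eq_iff)

lemma edgeE: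
  assumes "e \<in> edges T"
  obtains a b where "e = {a, b}" "a \<in> A" "b \<in> B" "adj T a b"
  using subsetD[OF edges_bip assms] assms that by (auto simp: adj_def)

lemma adj_AB: "adj T u v \<Longrightarrow> u \<in> A \<Longrightarrow> v \<in> B"
  and adj_BA: "adj T u v \<Longrightarrow> u \<in> B \<Longrightarrow> v \<in> A"
  using adjD disj by blast+

lemma adj_neq: "adj T u v \<Longrightarrow> u \<noteq> v"
  using adjD disj by blast

lemma finite_N: "finite (N v)"
  using finite_subset[OF _ finite_verts, of "N v"] V adjD by blast

lemma closed_set:
  assumes "u \<in> S" "u \<in> verts T" "\<And>x y. x \<in> S \<Longrightarrow> adj T x y \<Longrightarrow> y \<in> S"
  shows "verts T \<subseteq> S"
  using connected_closed_subset[OF conn] assms by blast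

text \<open>Adjacent vertices lie in different classes, so distinctness has to be checked only
  between vertices an even number of steps apart on the closed walk. The same holds in
  \<open>no6\<close>.\<close>

lemma no4:
  assumes "adj T a b" "adj T b c" "adj T c d" "adj T d a" "a \<noteq> c" "b \<noteq> d"
  shows False
proof -
  have "distinct [a, b, c, d]" using assms adj_neq by auto
  then have "cycle T [a, b, c, d]"
    using assms adjD V by (auto simp: cycle_def walk_def)
  then show False using tree by (auto simp: tree_def)
qed

lemma no6:
  assumes "adj T a b" "adj T b c" "adj T c d" "adj T d e" "adj T e f" "adj T f a"
    "distinct [a, c, e]" "distinct [b, d, f]"
  shows False
proof -
  have "{a, c, e} \<subseteq> A \<and> {b, d, f} \<subseteq> B \<or> {a, c, e} \<subseteq> B \<and> {b, d, f} \<subseteq> A"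
    using assms adjD disj by blast
  then have "distinct [a, b, c, d, e, f]" "{a, b, c, d, e, f} \<subseteq> verts T"
    using assms(7,8) disj V by auto
  then have "cycle T [a, b, c, d, e, f]"
    using assms by (auto simp: cycle_def walk_def)
  then show False using tree by (auto simp: tree_def)
qed

lemma N_nonempty:
  assumes "v \<in> verts T"
  shows "\<exists>u. adj T v u"
proof (rule ccontr)
  assume "\<nexists>u. adj T v u"
  then have "verts T \<subseteq> {v}" using assms by (intro closed_set[of v]) auto
  then show False using card3 card_mono[of "{v}" "verts T"] by simp
qed

lemma leaf_nbr_other:
  assumes "N v = {u}"
  obtains w where "adj T u w" "w \<noteq> v"
proof -
  have vu: "adj T v u" using assms by auto
  have "\<exists>w. adj T u w \<and> w \<noteq> v"
  proof (rule ccontr)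
    assume "\<not> ?thesis"
    then have "verts T \<subseteq> {v, u}" using assms vu adjD[OF vu] V by (intro closed_set[of v]) auto
    then have "card (verts T) \<le> 2"
      using card_mono[of "{v, u}" "verts T"] by (simp add: card_insert_if split: if_splits)
    then show False using card3 by simp
  qed
  then show ?thesis using that by blast
qed

text \<open>Each vertex of \<^term>\<open>A - D\<close> contributes one incident edge, the one prescribed by
  \<^term>\<open>M\<close> if there is one; the edges at \<^term>\<open>D\<close> are dominated at their other ends.\<close>

lemma card_drop:
  assumes D: "D \<subseteq> A" and sv: "single_valued M"
    and M: "\<And>a b. (a, b) \<in> M \<Longrightarrow> a \<in> A - D \<and> adj T a b"
    and range: "\<And>d b. d \<in> D \<Longrightarrow> adj T d b \<Longrightarrow> b \<in> Range M"
  shows "k + card D \<le> card A"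
proof -
  define h where "h a = (if a \<in> Domain M then SOME b. (a, b) \<in> M else SOME b. adj T a b)" for a
  have hM: "h a = b" if "(a, b) \<in> M" for a b
  proof -
    have "(a, h a) \<in> M" using that someI[of "\<lambda>b. (a, b) \<in> M"] by (auto simp: h_def)
    then show ?thesis using that sv by (auto simp: single_valued_def)
  qed
  have h: "adj T a (h a)" if a: "a \<in> A - D" for a
  proof (cases "a \<in> Domain M")
    case True
    then show ?thesis using hM M by blast
  next
    case False
    have "\<exists>b. adj T a b" using N_nonempty V a by blast
    then show ?thesis using False someI_ex[of "\<lambda>b. adj T a b"] by (simp add: h_def)
  qed
  let ?F = "(\<lambda>a. {a, h a}) ` (A - D)"
  have "k \<le> card ?F"
  proof (rule dominating_card)
    show "?F \<subseteq> edges T" using h by (auto simp: adj_def)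
    fix e assume "e \<in> edges T"
    then obtain a b where e: "e = {a, b}" "a \<in> A" "adj T a b"
      by (rule edgeE)
    show "\<exists>f\<in>?F. e \<inter> f \<noteq> {}"
    proof (cases "a \<in> D")
      case True
      then obtain a' where "(a', b) \<in> M" using range e by blast
      then show ?thesis using hM[of a' b] M[of a' b] e by (intro bexI[of _ "{a', h a'}"]) auto
    next
      case False
      then show ?thesis using e by (intro bexI[of _ "{a, h a}"]) auto
    qed
  qed
  also have "card ?F \<le> card (A - D)" by (intro card_image_le) (use finA in auto)
  also have "\<dots> = card A - card D" using D finA by (simp add: card_Diff_subset finite_subset)
  finally show ?thesis using card_mono[OF finA D] by linarith
qed

lemma k_le_card_A: "k \<le> card A"
  using card_drop[of "{}" "{}"] by auto

text \<open>Every edge has exactly one end in \<open>A\<close>, and a tree has one edge fewer than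
  vertices.\<close>

lemma degree_sum: "(\<Sum>a\<in>A. card (N a)) + 1 = card A + card B"
proof -
  have "bij_betw (\<lambda>(a, b). {a, b}) (SIGMA a:A. N a) (edges T)"
    unfolding bij_betw_def
  proof
    show "inj_on (\<lambda>(a, b). {a, b}) (SIGMA a:A. N a)"
      using adj_AB disj by (fastforce simp: inj_on_def doubleton_eq_iff)
    show "(\<lambda>(a, b). {a, b}) ` (SIGMA a:A. N a) = edges T"
    proof
      show "edges T \<subseteq> (\<lambda>(a, b). {a, b}) ` (SIGMA a:A. N a)"
        by (auto elim!: edgeE)
    qed (auto simp: adj_def)
  qed
  then have "card (edges T) = card (SIGMA a:A. N a)" by (simp add: bij_betw_same_card)
  also have "\<dots> = (\<Sum>a\<in>A. card (N a))" using finA finite_N by (simp add: card_SigmaI)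
  finally show ?thesis using tree_bipartite_card_edges[OF tree] card_V by metis
qed

text \<open>The boundary condition fixes all neighbours of every vertex x next to the core and of
  its leaf y. The core, these x and their y therefore form a set closed under adjacency, which is
  everything by connectedness, and all edges outside the core are known.\<close>

lemma attach_core:
  assumes C: "C \<subseteq> verts T" "C \<noteq> {}" "verts G = C" "edges G = {e \<in> edges T. e \<subseteq> C}"
    and bd: "\<And>p x. p \<in> C \<Longrightarrow> adj T p x \<Longrightarrow> x \<notin> C \<Longrightarrow>
      p \<in> At \<and> (\<exists>y. y \<notin> C \<and> N x = {y, p} \<and> N y = {x})"
  shows "attach_edges G At T"
proof -
  define X where "X = {x. x \<notin> C \<and> (\<exists>p\<in>C. adj T p x)}"
  have "\<exists>p y. p \<in> C \<and> p \<in> At \<and> y \<notin> C \<and> N x = {y, p} \<and> N y = {x}" if "x \<in> X" for x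
    using bd that by (fastforce simp: X_def)
  then obtain a y where ay: "\<And>x. x \<in> X \<Longrightarrow> a x \<in> C \<and> a x \<in> At \<and> y x \<notin> C \<and> N x = {y x, a x} \<and> N (y x) = {x}"
    by metis
  have ax: "a x \<in> C" "a x \<in> At" "y x \<notin> C" "N x = {y x, a x}" "N (y x) = {x}" if "x \<in> X" for x
    using ay[OF that] by auto
  have XC: "X \<inter> C = {}" by (auto simp: X_def)
  have adjX: "adj T x (y x)" "adj T x (a x)" if "x \<in> X" for x using ax[OF that] by auto
  have XV: "X \<subseteq> verts T" "y ` X \<subseteq> verts T"
    using adjX adjD V by blast+
  \<comment> \<open>Otherwise x, the only neighbour of \<open>y x\<close>, would be the attachment
    point of \<open>y x\<close> and lie in the core.\<close>
  have yX: "y x \<notin> X" if "x \<in> X" for x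
  proof
    assume "y x \<in> X"
    then have "a (y x) = x" using ax(4)[of "y x"] ax(5)[OF that] by auto
    then show False using ax(1)[OF \<open>y x \<in> X\<close>] XC that by auto
  qed
  have "verts T \<subseteq> C \<union> X \<union> y ` X"
  proof -
    obtain c where "c \<in> C" using C by blast
    show ?thesis
    proof (rule closed_set[of c])
      fix p q assume p: "p \<in> C \<union> X \<union> y ` X" and pq: "adj T p q"
      from p consider "p \<in> C" | "p \<in> X" | x where "x \<in> X" "p = y x" by blast
      then show "q \<in> C \<union> X \<union> y ` X"
      proof cases
        case 1 then show ?thesis using pq by (auto simp: X_def)
      next
        case 2
        then have "q \<in> {y p, a p}" using ax(4)[OF 2] pq by auto
        then show ?thesis using ax[OF 2] 2 by auto
      next
        case 3
        then have "q = x" using ax(5)[OF 3(1)] pq by auto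
        then show ?thesis using 3 by auto
      qed
    qed (use \<open>c \<in> C\<close> C in auto)
  qed
  then have VT: "verts T = C \<union> X \<union> y ` X" using XV C by auto
  have ET: "edges T = edges G \<union> {{x, y x} | x. x \<in> X} \<union> {{x, a x} | x. x \<in> X}" (is "_ = ?R")
  proof
    show "?R \<subseteq> edges T" using C adjX by (auto simp: adj_def)
    show "edges T \<subseteq> ?R"
    proof
      fix e assume e: "e \<in> edges T"
      then obtain p q where pq: "e = {p, q}" "adj T p q" using simple_graph_edgeE[OF sg] by blast
      have incX: "{v, w} \<in> ?R" if "v \<in> X" "adj T v w" for v w
      proof -
        have "w = y v \<or> w = a v" using ax(4)[OF that(1)] that(2) by auto
        then show ?thesis using that(1) by blast
      qed
      have incY: "{v, w} \<in> ?R" if v: "v \<in> y ` X" "adj T v w" for v w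
      proof -
        obtain x where x: "x \<in> X" "v = y x" using v(1) by blast
        then have "w = x" using ax(5)[OF x(1)] v(2) by auto
        then show ?thesis using incX[OF x(1) adjX(1)[OF x(1)]] x(2) by (simp add: insert_commute)
      qed
      have qp: "adj T q p" using pq adj_sym by metis
      have "e = {q, p}" using pq by auto
      show "e \<in> ?R"
      proof (cases "p \<in> C \<and> q \<in> C")
        case True
        then show ?thesis using e pq C by auto
      next
        case False
        then have "p \<in> X \<or> q \<in> X \<or> p \<in> y ` X \<or> q \<in> y ` X"
          using VT adjD[OF pq(2)] V by blast
        then show ?thesis using incX[OF _ pq(2)] incX[OF _ qp] incY[OF _ pq(2)] incY[OF _ qp] pq(1) \<open>e = {q, p}\<close>
          by metis
      qed
    qed
  qed
  show ?thesis
  proof (rule attach_edgesI[of X y G a])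
    show "finite X" using XV finite_verts finite_subset by blast
    show "inj_on y X" using ax(5) by (metis inj_onI singleton_inject)
    show "X \<inter> y ` X = {}" using yX by blast
    show "(X \<union> y ` X) \<inter> verts G = {}" using XC ax(3) C by auto
    show "a ` X \<subseteq> At" using ax(2) by blast
    show "verts T = verts G \<union> X \<union> y ` X" using VT C by simp
    show "edges T = edges G \<union> {{x, y x} | x. x \<in> X} \<union> {{x, a x} | x. x \<in> X}" by (rule ET)
  qed
qed

text \<open>If every vertex of the core has a neighbour in the core, then a leaf attached outside
  the core cannot lie in the core.\<close>

lemma attach_core':
  assumes C: "C \<subseteq> verts T" "C \<noteq> {}" "verts G = C" "edges G = {e \<in> edges T. e \<subseteq> C}"
    and inner: "\<And>p. p \<in> C \<Longrightarrow> \<exists>q\<in>C. adj T p q"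
    and bd: "\<And>p x. p \<in> C \<Longrightarrow> adj T p x \<Longrightarrow> x \<notin> C \<Longrightarrow>
      p \<in> At \<and> (\<exists>y. N x = {y, p} \<and> N y = {x})"
  shows "attach_edges G At T"
proof (rule attach_core[OF C])
  fix p x assume px: "p \<in> C" "adj T p x" "x \<notin> C"
  then obtain y where y: "p \<in> At" "N x = {y, p}" "N y = {x}" using bd by blast
  have "y \<notin> C"
  proof
    assume "y \<in> C"
    then obtain q where "q \<in> C" "adj T y q" using inner by blast
    then show False using y(3) px(3) by auto
  qed
  then show "p \<in> At \<and> (\<exists>y. y \<notin> C \<and> N x = {y, p} \<and> N y = {x})" using y by blast
qed

section \<open>Recognising the extremal trees by their neighbourhoods\<close>

lemma N_iff: "N v = S \<Longrightarrow> adj T v z \<longleftrightarrow> z \<in> S"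
  and N_iff': "N v = S \<Longrightarrow> adj T z v \<longleftrightarrow> z \<in> S"
  using adj_sym[of T] by auto

lemma adj_verts: "adj T u v \<Longrightarrow> u \<in> verts T" "adj T u v \<Longrightarrow> v \<in> verts T"
  using adjD V by blast+

lemma induced_edges_subset:
  assumes "\<And>p q. p \<in> C \<Longrightarrow> q \<in> C \<Longrightarrow> adj T p q \<Longrightarrow> {p, q} \<in> R"
  shows "{e \<in> edges T. e \<subseteq> C} \<subseteq> R"
proof
  fix e assume e: "e \<in> {e \<in> edges T. e \<subseteq> C}"
  then obtain p q where "e = {p, q}" "adj T p q" using simple_graph_edgeE[OF sg] by blast
  then show "e \<in> R" using e assms by auto
qed

text \<open>All neighbourhoods in the core except those of the two hubs are prescribed, so the edges
  induced on the core are determined once the adjacency of the hubs is known. The lemmas for the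
  other two families of (iv) follow the same pattern.\<close>

lemma extremal_even_A:
  assumes d: "distinct [u0, u1, u2, u3, u4, u5]"
    and N: "N u0 = {u1}" "N u1 = {u0, u2}" "N u4 = {u3, u5}" "N u5 = {u4}" and hubs: "adj T u2 u3"
    and pend: "\<And>p x. p \<in> {u2, u3} \<Longrightarrow> adj T p x \<Longrightarrow> x \<notin> {u0, u1, u2, u3, u4, u5} \<Longrightarrow>
      \<exists>y. N x = {y, p} \<and> N y = {x}"
  shows "extremal_even T"
proof -
  let ?u = "[u0, u1, u2, u3, u4, u5]"
  note iffs = N_iff[OF N(1)] N_iff[OF N(2)] N_iff[OF N(3)] N_iff[OF N(4)]
    N_iff'[OF N(1)] N_iff'[OF N(2)] N_iff'[OF N(3)] N_iff'[OF N(4)]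
  have hubs': "adj T u3 u2" using hubs adj_sym by metis
  have irr: "\<not> adj T z z" for z using adj_neq by blast
  have E: "edges (path_on ?u) = {{u0, u1}, {u1, u2}, {u2, u3}, {u3, u4}, {u4, u5}}"
    by (simp add: edges_path_on_Cons_Cons edges_path_on_single)
  have adjs: "adj T u0 u1" "adj T u1 u2" "adj T u2 u3" "adj T u3 u4" "adj T u4 u5"
    using hubs by (simp_all add: iffs)
  have sub: "set ?u \<subseteq> verts T"
    using adjs[THEN adj_verts(1)] adjs[THEN adj_verts(2)] by simp
  have att: "attach_edges (path_on ?u) {u2, u3} T"
  proof (rule attach_core'[of "set ?u"])
    show "edges (path_on ?u) = {e \<in> edges T. e \<subseteq> set ?u}"
    proof
      show "edges (path_on ?u) \<subseteq> {e \<in> edges T. e \<subseteq> set ?u}"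
        using adjs by (simp add: E adj_def)
      show "{e \<in> edges T. e \<subseteq> set ?u} \<subseteq> edges (path_on ?u)"
      proof (rule induced_edges_subset)
        have "\<forall>x\<in>set ?u. \<forall>y\<in>set ?u. adj T x y \<longrightarrow> {x, y} \<in> edges (path_on ?u)"
          using d by (simp add: iffs irr doubleton_eq_iff E)
        then show "{x, y} \<in> edges (path_on ?u)" if "x \<in> set ?u" "y \<in> set ?u" "adj T x y" for x y
          using that by blast
      qed
    qed
    show "\<exists>q\<in>set ?u. adj T p q" if "p \<in> set ?u" for p
      using that hubs hubs' by (auto simp: iffs)
    show "p \<in> {u2, u3} \<and> (\<exists>y. N x = {y, p} \<and> N y = {x})"
      if "p \<in> set ?u" "adj T p x" "x \<notin> set ?u" for p x
    proof -
      have "p \<in> {u2, u3}" using that by (auto simp: iffs)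
      then show ?thesis using pend[of p x] that by simp
    qed
  qed (use sub in \<open>auto simp: verts_path_on\<close>)
  have "long_family T" unfolding long_family_def
    using att d by (intro disjI1 exI[of _ ?u]) simp
  moreover have "5 \<le> diam T"
    by (rule diam_ge_attach_path[OF att finite_verts conn]) (use d in auto)
  ultimately show ?thesis by (simp add: extremal_even_def)
qed

lemma extremal_even_B:
  assumes d: "distinct [u0, u1, u2, u3, u4, u5, u6, v]"
    and N: "N u0 = {u1}" "N u1 = {u0, u2}" "N u3 = {u2, u4, v}" "N u5 = {u4, u6}" "N u6 = {u5}"
      "N v = {u3}"
    and hubs: "\<not> adj T u2 u4"
    and pend: "\<And>p x. p \<in> {u2, u4} \<Longrightarrow> adj T p x \<Longrightarrow> x \<notin> {u0, u1, u2, u3, u4, u5, u6, v} \<Longrightarrow>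
      \<exists>y. N x = {y, p} \<and> N y = {x}"
  shows "extremal_even T"
proof -
  let ?u = "[u0, u1, u2, u3, u4, u5, u6]"
  let ?G = "add_leaf (path_on ?u) u3 v"
  note iffs = N_iff[OF N(1)] N_iff[OF N(2)] N_iff[OF N(3)] N_iff[OF N(4)] N_iff[OF N(5)]
    N_iff[OF N(6)] N_iff'[OF N(1)] N_iff'[OF N(2)] N_iff'[OF N(3)] N_iff'[OF N(4)]
    N_iff'[OF N(5)] N_iff'[OF N(6)]
  have hubs': "\<not> adj T u4 u2" using hubs adj_sym by metis
  have irr: "\<not> adj T z z" for z using adj_neq by blast
  have E: "edges ?G = {{u3, v}, {u0, u1}, {u1, u2}, {u2, u3}, {u3, u4}, {u4, u5}, {u5, u6}}"
    by (simp add: add_leaf_def edges_path_on_Cons_Cons edges_path_on_single)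
  have adjs: "adj T u3 v" "adj T u0 u1" "adj T u1 u2" "adj T u2 u3" "adj T u3 u4" "adj T u4 u5" "adj T u5 u6"
    by (simp_all add: iffs)
  have sub: "insert v (set ?u) \<subseteq> verts T"
    using adjs[THEN adj_verts(1)] adjs[THEN adj_verts(2)] by simp
  have att: "attach_edges ?G {u2, u4} T"
  proof (rule attach_core'[of "insert v (set ?u)"])
    show "edges ?G = {e \<in> edges T. e \<subseteq> insert v (set ?u)}"
    proof
      show "edges ?G \<subseteq> {e \<in> edges T. e \<subseteq> insert v (set ?u)}"
        using adjs by (simp add: E adj_def)
      show "{e \<in> edges T. e \<subseteq> insert v (set ?u)} \<subseteq> edges ?G"
      proof (rule induced_edges_subset)
        have "\<forall>x\<in>insert v (set ?u). \<forall>y\<in>insert v (set ?u). adj T x y \<longrightarrow> {x, y} \<in> edges ?G"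
          using d hubs hubs' by (simp add: iffs irr doubleton_eq_iff E)
        then show "{x, y} \<in> edges ?G" if "x \<in> insert v (set ?u)" "y \<in> insert v (set ?u)" "adj T x y" for x y
          using that by blast
      qed
    qed
    show "\<exists>q\<in>insert v (set ?u). adj T p q" if "p \<in> insert v (set ?u)" for p
      using that by (auto simp: iffs)
    show "p \<in> {u2, u4} \<and> (\<exists>y. N x = {y, p} \<and> N y = {x})"
      if "p \<in> insert v (set ?u)" "adj T p x" "x \<notin> insert v (set ?u)" for p x
    proof -
      have "p \<in> {u2, u4}" using that by (auto simp: iffs)
      then show ?thesis using pend[of p x] that by simp
    qed
  qed (use sub in \<open>auto simp: verts_path_on add_leaf_def\<close>)
  have "long_family T" unfolding long_family_def
    using att d by (intro disjI2[OF disjI1] exI[of _ ?u] exI[of _ v]) auto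
  moreover have "5 \<le> diam T"
    by (rule diam_ge_attach_path_leaf[of ?u 3 v "{u2, u4}", OF _ finite_verts conn])
      (use att d in auto)
  ultimately show ?thesis by (simp add: extremal_even_def)
qed

lemma extremal_even_C:
  assumes d: "distinct [u0, u1, u2, u3, u4, u5, u6, u7]"
    and N: "N u0 = {u1}" "N u1 = {u0, u2}" "N u3 = {u2, u4}" "N u4 = {u3, u5}"
      "N u6 = {u5, u7}" "N u7 = {u6}"
    and pend: "\<And>p x. p \<in> {u2, u5} \<Longrightarrow> adj T p x \<Longrightarrow>
      x \<notin> {u0, u1, u2, u3, u4, u5, u6, u7} \<Longrightarrow> \<exists>y. N x = {y, p} \<and> N y = {x}"
  shows "extremal_even T"
proof -
  let ?u = "[u0, u1, u2, u3, u4, u5, u6, u7]"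
  note iffs = N_iff[OF N(1)] N_iff[OF N(2)] N_iff[OF N(3)] N_iff[OF N(4)] N_iff[OF N(5)]
    N_iff[OF N(6)] N_iff'[OF N(1)] N_iff'[OF N(2)] N_iff'[OF N(3)] N_iff'[OF N(4)]
    N_iff'[OF N(5)] N_iff'[OF N(6)]
  \<comment> \<open>The hubs have different colours here, so bipartiteness does not separate them;
    an edge between them would close the 4-cycle u2, u3, u4, u5.\<close>
  have hubs: "\<not> adj T u5 u2" using no4[of u2 u3 u4 u5] d by (auto simp: iffs)
  then have hubs': "\<not> adj T u2 u5" using adj_sym by metis
  have irr: "\<not> adj T z z" for z using adj_neq by blast
  have E: "edges (path_on ?u) =
      {{u0, u1}, {u1, u2}, {u2, u3}, {u3, u4}, {u4, u5}, {u5, u6}, {u6, u7}}"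
    by (simp add: edges_path_on_Cons_Cons edges_path_on_single)
  have adjs: "adj T u0 u1" "adj T u1 u2" "adj T u2 u3" "adj T u3 u4" "adj T u4 u5" "adj T u5 u6" "adj T u6 u7"
    by (simp_all add: iffs)
  have sub: "set ?u \<subseteq> verts T"
    using adjs[THEN adj_verts(1)] adjs[THEN adj_verts(2)] by simp
  have att: "attach_edges (path_on ?u) {u2, u5} T"
  proof (rule attach_core'[of "set ?u"])
    show "edges (path_on ?u) = {e \<in> edges T. e \<subseteq> set ?u}"
    proof
      show "edges (path_on ?u) \<subseteq> {e \<in> edges T. e \<subseteq> set ?u}"
        using adjs by (simp add: E adj_def)
      show "{e \<in> edges T. e \<subseteq> set ?u} \<subseteq> edges (path_on ?u)"
      proof (rule induced_edges_subset)
        have "\<forall>x\<in>set ?u. \<forall>y\<in>set ?u. adj T x y \<longrightarrow> {x, y} \<in> edges (path_on ?u)"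
          using d hubs hubs' by (simp add: iffs irr doubleton_eq_iff E)
        then show "{x, y} \<in> edges (path_on ?u)" if "x \<in> set ?u" "y \<in> set ?u" "adj T x y" for x y
          using that by blast
      qed
    qed
    show "\<exists>q\<in>set ?u. adj T p q" if "p \<in> set ?u" for p
      using that by (auto simp: iffs)
    show "p \<in> {u2, u5} \<and> (\<exists>y. N x = {y, p} \<and> N y = {x})"
      if "p \<in> set ?u" "adj T p x" "x \<notin> set ?u" for p x
    proof -
      have "p \<in> {u2, u5}" using that by (auto simp: iffs)
      then show ?thesis using pend[of p x] that by simp
    qed
  qed (use sub in \<open>auto simp: verts_path_on\<close>)
  have "long_family T" unfolding long_family_def
    using att d by (intro disjI2 exI[of _ ?u]) simp
  moreover have "5 \<le> diam T"
    by (rule diam_ge_attach_path[OF att finite_verts conn]) (use d in auto)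
  ultimately show ?thesis by (simp add: extremal_even_def)
qed

lemma leafI: "N w = {c} \<Longrightarrow> leaf T w"
proof -
  assume N: "N w = {c}"
  then have "{u \<in> verts T. adj T w u} = {c}" using adj_verts by blast
  moreover have "w \<in> verts T" using N adj_verts by blast
  ultimately show "leaf T w" by (simp add: leaf_def degree_def)
qed

text \<open>The vertices within distance two of \<open>c\<close> form a closed set. \<open>W\<close>
  collects the leaves hanging at \<open>v\<close>; it has no, one or two elements in the
  applications.\<close>

lemma diam_le_4_of_pendant:
  assumes c: "c \<in> verts T" and near: "\<And>v. adj T c v \<Longrightarrow> \<exists>W. N v = insert c W \<and> (\<forall>w\<in>W. N w = {v})"
  shows "diam T \<le> 4"
proof (rule diam_le_4[OF finite_verts c])
  let ?S = "{v. v = c \<or> adj T v c \<or> (\<exists>w\<in>verts T. adj T v w \<and> adj T w c)}"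
  have "verts T \<subseteq> ?S"
  proof (rule closed_set[of c])
    fix x y assume x: "x \<in> ?S" and xy: "adj T x y"
    have yx: "adj T y x" using xy adj_sym by metis
    show "y \<in> ?S"
    proof (cases "x = c \<or> adj T x c")
      case True then show ?thesis using yx adj_verts[OF xy] by blast
    next
      case False
      then obtain w where w: "adj T x w" "adj T w c" using x by blast
      obtain W where W: "N w = insert c W" "\<forall>w'\<in>W. N w' = {w}" using near w(2) adj_sym by metis
      have "x \<in> W" using W(1) w(1) False adj_sym[of T x w] by auto
      then have "y = w" using W(2) xy by auto
      then show ?thesis using w by simp
    qed
  qed (use c in auto)
  then show "v = c \<or> adj T v c \<or> (\<exists>w\<in>verts T. adj T v w \<and> adj T w c)" if "v \<in> verts T" for v
    using that by blast
qed

text \<open>The extra leaf w sits at the centre. It is not the inner vertex of an attached edge, so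
  the core is \<open>{c, w}\<close>, and deleting w leaves a spider.\<close>

lemma extremal_even_spider_center:
  assumes w: "N w = {c}"
    and pend: "\<And>x. adj T c x \<Longrightarrow> x \<noteq> w \<Longrightarrow> \<exists>y. N x = {y, c} \<and> N y = {x}"
  shows "extremal_even T"
proof -
  let ?G = "Graph {c, w} {{c, w}}"
  note iffs = N_iff[OF w] N_iff'[OF w]
  have wc: "adj T w c" "adj T c w" by (simp_all add: iffs)
  have cw: "c \<noteq> w" using adj_neq wc(1) by blast
  have irr: "\<not> adj T z z" for z using adj_neq by blast
  have c: "c \<in> verts T" "w \<in> verts T" using adj_verts[OF wc(1)] by auto
  have "attach_edges ?G {c} T"
  proof (rule attach_core'[of "{c, w}"])
    show "edges ?G = {e \<in> edges T. e \<subseteq> {c, w}}"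
    proof
      show "edges ?G \<subseteq> {e \<in> edges T. e \<subseteq> {c, w}}" using wc by (simp add: adj_def)
      show "{e \<in> edges T. e \<subseteq> {c, w}} \<subseteq> edges ?G"
      proof (rule induced_edges_subset)
        have "\<forall>x\<in>{c, w}. \<forall>y\<in>{c, w}. adj T x y \<longrightarrow> {x, y} \<in> edges ?G"
          by (simp add: iffs irr doubleton_eq_iff)
        then show "{x, y} \<in> edges ?G" if "x \<in> {c, w}" "y \<in> {c, w}" "adj T x y" for x y
          using that by blast
      qed
    qed
    show "p \<in> {c} \<and> (\<exists>y. N x = {y, p} \<and> N y = {x})"
      if "p \<in> {c, w}" "adj T p x" "x \<notin> {c, w}" for p x
      using that pend[of x] by (auto simp: iffs)
  qed (use c wc in auto)
  then have "attach_edges (delete_vertex ?G w) {c} (delete_vertex T w)"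
    using cw by (intro attach_edges_delete_vertex) auto
  moreover have "delete_vertex ?G w = Graph {c} {}" using cw by (auto simp: delete_vertex_def)
  ultimately have "spider_with_leaf T"
    unfolding spider_with_leaf_def using leafI[OF w] by auto
  moreover have "diam T \<le> 4"
  proof (rule diam_le_4_of_pendant[OF c(1)])
    fix v assume v: "adj T c v"
    show "\<exists>W. N v = insert c W \<and> (\<forall>w\<in>W. N w = {v})"
    proof (cases "v = w")
      case True then show ?thesis using w by (intro exI[of _ "{}"]) auto
    next
      case False
      then obtain y where "N v = {y, c}" "N y = {v}" using pend v by blast
      then show ?thesis by (intro exI[of _ "{y}"]) auto
    qed
  qed
  ultimately show ?thesis by (simp add: extremal_even_def)
qed

text \<open>The extra leaf w sits at the middle vertex p of a leg. After its deletion the rest c, p,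
  q of the core is an ordinary leg, which \<open>attach_edges_shrink_base\<close> absorbs.\<close>

lemma extremal_even_spider_leg:
  assumes d: "distinct [c, p, q, w]" and N: "N p = {c, q, w}" "N q = {p}" "N w = {p}"
    and pend: "\<And>x. adj T c x \<Longrightarrow> x \<noteq> p \<Longrightarrow> \<exists>y. N x = {y, c} \<and> N y = {x}"
  shows "extremal_even T"
proof -
  let ?C = "{c, p, q, w}"
  let ?G = "Graph ?C {{p, c}, {p, q}, {p, w}}"
  note iffs = N_iff[OF N(1)] N_iff[OF N(2)] N_iff[OF N(3)]
    N_iff'[OF N(1)] N_iff'[OF N(2)] N_iff'[OF N(3)]
  have irr: "\<not> adj T z z" for z using adj_neq by blast
  have adjs: "adj T p c" "adj T p w" "adj T p q" by (simp_all add: iffs)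
  have C: "?C \<subseteq> verts T" using adjs[THEN adj_verts(1)] adjs[THEN adj_verts(2)] by simp
  have "attach_edges ?G {c} T"
  proof (rule attach_core'[of ?C])
    show "edges ?G = {e \<in> edges T. e \<subseteq> ?C}"
    proof
      show "edges ?G \<subseteq> {e \<in> edges T. e \<subseteq> ?C}" using adjs by (simp add: adj_def)
      show "{e \<in> edges T. e \<subseteq> ?C} \<subseteq> edges ?G"
      proof (rule induced_edges_subset)
        have "\<forall>x\<in>?C. \<forall>y\<in>?C. adj T x y \<longrightarrow> {x, y} \<in> edges ?G"
          using d by (simp add: iffs irr doubleton_eq_iff)
        then show "{x, y} \<in> edges ?G" if "x \<in> ?C" "y \<in> ?C" "adj T x y" for x y
          using that by blast
      qed
    qed
    show "\<exists>z\<in>?C. adj T v z" if "v \<in> ?C" for v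
      using that by (auto simp: iffs)
    show "v \<in> {c} \<and> (\<exists>y. N x = {y, v} \<and> N y = {x})"
      if "v \<in> ?C" "adj T v x" "x \<notin> ?C" for v x
      using that pend[of x] by (auto simp: iffs)
  qed (use C in auto)
  then have "attach_edges (delete_vertex ?G w) {c} (delete_vertex T w)"
    using d by (intro attach_edges_delete_vertex) auto
  moreover have "delete_vertex ?G w = Graph {c, p, q} {{p, q}, {p, c}}"
    using d by (auto simp: delete_vertex_def)
  ultimately have "attach_edges (Graph {c} {}) {c} (delete_vertex T w)"
    using d by (intro attach_edges_shrink_base[of c p q]) auto
  then have "spider_with_leaf T"
    unfolding spider_with_leaf_def using leafI[OF N(3)] by auto
  moreover have "diam T \<le> 4"
  proof (rule diam_le_4_of_pendant)
    show "c \<in> verts T" using C by simp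
    fix v assume v: "adj T c v"
    show "\<exists>W. N v = insert c W \<and> (\<forall>w\<in>W. N w = {v})"
    proof (cases "v = p")
      case True then show ?thesis using N by (intro exI[of _ "{q, w}"]) auto
    next
      case False
      then obtain y where "N v = {y, c}" "N y = {v}" using pend v by blast
      then show ?thesis by (intro exI[of _ "{y}"]) auto
    qed
  qed
  ultimately show ?thesis by (simp add: extremal_even_def)
qed

end

section \<open>Colour classes of different sizes\<close>

lemma sum_eq_twice_cardD:
  fixes f :: "'a \<Rightarrow> nat"
  assumes "finite S" "\<And>x. x \<in> S \<Longrightarrow> 2 \<le> f x" "sum f S = 2 * card S" "x \<in> S"
  shows "f x = 2"
proof -
  have "(\<Sum>x\<in>S. f x - 2) = 0" using assms(2,3) by (subst sum_subtractf_nat) auto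
  then show ?thesis using assms(1,2,4) by fastforce
qed

lemma sum_eq_Suc_twice_cardD:
  fixes f :: "'a \<Rightarrow> nat"
  assumes "finite S" "\<And>x. x \<in> S \<Longrightarrow> 2 \<le> f x" "sum f S = Suc (2 * card S)"
  obtains x where "x \<in> S" "f x = 3" "\<And>y. y \<in> S \<Longrightarrow> y \<noteq> x \<Longrightarrow> f y = 2"
proof -
  have "(\<Sum>x\<in>S. f x - 2) = Suc 0" using assms(2,3) by (subst sum_subtractf_nat) auto
  then have "\<exists>x\<in>S. f x - 2 = Suc 0 \<and> (\<forall>y\<in>S. x \<noteq> y \<longrightarrow> f y - 2 = 0)"
    unfolding sum_eq_Suc0_iff[OF assms(1)] .
  then obtain x where x: "x \<in> S" "f x - 2 = Suc 0" "\<forall>y\<in>S. x \<noteq> y \<longrightarrow> f y - 2 = 0"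
    by blast
  show ?thesis
  proof (rule that[OF x(1)])
    show "f x = 3" using x(2) by simp
    show "f y = 2" if "y \<in> S" "y \<noteq> x" for y using x(3) assms(2)[of y] that by fastforce
  qed
qed

lemma card_2_eqD:
  assumes "card S = 2" "x \<in> S" "y \<in> S" "x \<noteq> y"
  shows "S = {x, y}"
  using assms by (auto simp: card_2_iff)

lemma card_2_otherE:
  assumes "card S = 2" "x \<in> S"
  obtains y where "S = {x, y}" "x \<noteq> y"
  using assms by (auto simp: card_2_iff)

context bipartite_tree
begin

lemma adjI: "N v = S \<Longrightarrow> u \<in> S \<Longrightarrow> adj T v u"
  and adjI': "N v = S \<Longrightarrow> u \<in> S \<Longrightarrow> adj T u v"
  using adj_sym[of T u v] by auto

text \<open>If every neighbour b of a had another neighbour \<open>g b\<close>, the edges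
  \<open>{g b, b}\<close> would cover \<open>N a\<close> and a could be dropped. They belong to
  different vertices, because \<open>g b = g b'\<close> closes the 4-cycle a, b, \<open>g b\<close>,
  \<open>b'\<close>.\<close>

lemma tight_leaf_nbr:
  assumes k: "card A = k" and a: "a \<in> A"
  obtains b where "N b = {a}"
proof -
  have "\<exists>b. N b = {a}"
  proof (rule ccontr)
    assume no: "\<nexists>b. N b = {a}"
    have "\<exists>c. adj T b c \<and> c \<noteq> a" if ab: "adj T a b" for b
    proof (rule ccontr)
      assume "\<nexists>c. adj T b c \<and> c \<noteq> a"
      moreover have "adj T b a" using ab adj_sym[of T a b] by simp
      ultimately have "N b = {a}" by blast
      then show False using no by blast
    qed
    then obtain g where g: "\<And>b. adj T a b \<Longrightarrow> adj T b (g b) \<and> g b \<noteq> a" by metis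
    have "k + card {a} \<le> card A"
    proof (rule card_drop[of "{a}" "(\<lambda>b. (g b, b)) ` N a"])
      show "single_valued ((\<lambda>b. (g b, b)) ` N a)"
      proof (rule single_valuedI, clarsimp)
        fix b b' assume bb: "adj T a b" "adj T a b'" "g b = g b'"
        show "b = b'"
        proof (rule ccontr)
          assume "b \<noteq> b'"
          moreover have "adj T b (g b)" "adj T (g b) b'" "adj T b' a" "g b \<noteq> a"
            using g[OF bb(1)] g[OF bb(2)] bb adj_sym[of T] by metis+
          ultimately show False using no4[OF bb(1)] by blast
        qed
      qed
      show "x \<in> A - {a} \<and> adj T x b" if "(x, b) \<in> (\<lambda>b. (g b, b)) ` N a" for x b
      proof -
        have ab: "adj T a b" "x = g b" using that by auto
        then show ?thesis using g[OF ab(1)] adj_AB[OF ab(1) a] adj_BA adj_sym[of T] by auto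
      qed
    qed (use a in auto)
    then show False using k by simp
  qed
  then show ?thesis using that by blast
qed

text \<open>If a had only its leaf neighbour b, the two would form a component of order 2.\<close>

lemma tight_degree_ge_2:
  assumes k: "card A = k" and a: "a \<in> A"
  shows "2 \<le> card (N a)"
proof (rule ccontr)
  assume "\<not> 2 \<le> card (N a)"
  moreover obtain b where b: "N b = {a}" using tight_leaf_nbr[OF assms] .
  moreover have "b \<in> N a" using adjI'[OF b] by auto
  moreover have "card (N a) \<noteq> 0" using finite_N[of a] \<open>b \<in> N a\<close> by auto
  ultimately have "card (N a) = 1" by linarith
  then obtain x where "N a = {x}" by (rule card_1_singletonE)
  then have "N a = {b}" using \<open>b \<in> N a\<close> by (metis singletonD)
  then obtain w where "adj T b w" "w \<noteq> a" using leaf_nbr_other by blast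
  then show False using N_iff[OF b] by auto
qed

text \<open>The degrees over A are at least 2 and average 2, so each vertex of A has exactly one
  neighbour besides a leaf. For a single a1 this other neighbour is c, and every vertex adjacent to
  c is then the middle of a leg.\<close>

lemma odd_case:
  assumes k: "card A = k" "card B = k + 1"
  obtains c where "attach_edges (Graph {c} {}) {c} T"
proof -
  have sum: "(\<Sum>a\<in>A. card (N a)) = 2 * card A" using degree_sum k by simp
  have deg: "card (N a) = 2" if "a \<in> A" for a
    using sum_eq_twice_cardD[OF finA _ sum that] tight_degree_ge_2[OF k(1)] by blast
  have "A \<noteq> {}" using card3 card_V k by auto
  then obtain a1 where a1: "a1 \<in> A" by blast
  obtain y1 where y1: "N y1 = {a1}" using tight_leaf_nbr[OF k(1) a1] .
  have "y1 \<in> N a1" using adjI'[OF y1] by auto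
  then obtain c where c: "N a1 = {y1, c}" "y1 \<noteq> c" using card_2_otherE[OF deg[OF a1]] by metis
  have ca1: "adj T c a1" "adj T a1 c" using adjI'[OF c(1)] adjI[OF c(1)] by auto
  have cB: "c \<in> B" using adj_AB[OF ca1(2) a1] .
  have "attach_edges (Graph {c} {}) {c} T"
  \<comment> \<open>A core of one vertex has no inner edge, so \<open>attach_core'\<close> does not
    apply and the leaf is shown to differ from c directly.\<close>
  proof (rule attach_core[of "{c}"])
    have "{e \<in> edges T. e \<subseteq> {c}} \<subseteq> {}"
      by (rule induced_edges_subset) (use adj_neq in blast)
    then show "edges (Graph {c} {}) = {e \<in> edges T. e \<subseteq> {c}}" by auto
    fix p x assume px: "p \<in> {c}" "adj T p x" "x \<notin> {c}"
    then have cx: "adj T c x" "adj T x c" using adj_sym[of T c x] by auto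
    have xA: "x \<in> A" using adj_BA[OF cx(1) cB] .
    show "p \<in> {c} \<and> (\<exists>y. y \<notin> {c} \<and> N x = {y, p} \<and> N y = {x})"
    proof (cases "x = a1")
      case True
      then show ?thesis using c y1 px by blast
    next
      case False
      obtain y where y: "N y = {x}" using tight_leaf_nbr[OF k(1) xA] .
      have "y \<noteq> c" using N_iff[OF y, of a1] ca1 False by auto
      moreover have "N x = {y, c}"
        using deg[OF xA] adjI'[OF y] cx calculation by (intro card_2_eqD) auto
      ultimately show ?thesis using y px by blast
    qed
  qed (use cB V in auto)
  then show ?thesis using that by blast
qed

text \<open>The degree sum leaves room for one vertex a0 of degree 3, with a leaf neighbour b1 and
  two more neighbours b2, b3. Every further neighbour of b2 or b3 is the inner vertex of an attached
  edge. If b2 or b3 is a leaf, the other one is the centre of a spider and b1 is the extra leaf on a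
  leg; otherwise family (b) arises, with a0 in the middle of the path.\<close>

lemma even_case_unbalanced:
  assumes k: "card A = k" "card B = k + 2"
  shows "extremal_even T"
proof -
  have "(\<Sum>a\<in>A. card (N a)) = Suc (2 * card A)" using degree_sum k by simp
  from sum_eq_Suc_twice_cardD[OF finA tight_degree_ge_2[OF k(1)] this]
  obtain a0 where a0: "a0 \<in> A" "card (N a0) = 3"
    and deg: "\<And>a. a \<in> A \<Longrightarrow> a \<noteq> a0 \<Longrightarrow> card (N a) = 2"
    by blast
  obtain b1 where b1: "N b1 = {a0}" using tight_leaf_nbr[OF k(1) a0(1)] .
  have "card (N a0 - {b1}) = 2" using a0(2) adjI'[OF b1] by (simp add: card_Diff_singleton)
  then obtain b2 b3 where "N a0 - {b1} = {b2, b3}" "b2 \<noteq> b3" by (auto simp: card_2_iff)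
  then have b: "N a0 = {b2, b3, b1}" "b2 \<noteq> b3" "b1 \<noteq> b2" "b1 \<noteq> b3" using adjI'[OF b1] by auto
  have hub: "adj T p a0" "adj T a0 p" "p \<in> B" if "p \<in> {b2, b3}" for p
    using adjI'[OF b(1)] adjI[OF b(1)] adj_AB[OF _ a0(1)] that by auto
  have B: "b1 \<in> B" "b2 \<in> B" "b3 \<in> B" using hub(3) adj_AB[OF adjI'[OF b1] a0(1)] by auto
  have ab: "a0 \<notin> {b1, b2, b3}" using B a0(1) disj by auto
  have pend: "\<exists>y. N x = {y, p} \<and> N y = {x}" if px: "p \<in> {b2, b3}" "adj T p x" "x \<noteq> a0" for p x
  proof -
    have xA: "x \<in> A" using adj_BA[OF px(2) hub(3)[OF px(1)]] .
    obtain y where y: "N y = {x}" using tight_leaf_nbr[OF k(1) xA] .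
    have "y \<noteq> p" using N_iff[OF y, of a0] hub(1)[OF px(1)] px(3) by auto
    moreover have "adj T x p" using px(2) adj_sym by metis
    ultimately have "N x = {y, p}" using deg[OF xA px(3)] adjI'[OF y] by (intro card_2_eqD) auto
    then show ?thesis using y by blast
  qed
  show ?thesis
  proof (cases "N b2 = {a0} \<or> N b3 = {a0}")
    case True
    then show ?thesis
    proof
      assume b2: "N b2 = {a0}"
      show ?thesis
      proof (rule extremal_even_spider_leg[of b3 a0 b2 b1])
        show "distinct [b3, a0, b2, b1]" using b(2-) ab by auto
        show "N a0 = {b3, b2, b1}" using b by auto
      qed (use b1 b2 pend in auto)
    next
      assume b3: "N b3 = {a0}"
      show ?thesis
      proof (rule extremal_even_spider_leg[of b2 a0 b3 b1])
        show "distinct [b2, a0, b3, b1]" using b(2-) ab by auto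
      qed (use b b1 b3 pend in auto)
    qed
  next
    case False
    have "\<exists>x. adj T b2 x \<and> x \<noteq> a0" "\<exists>x. adj T b3 x \<and> x \<noteq> a0" using False hub by blast+
    then obtain x2 x3 where x: "adj T b2 x2" "x2 \<noteq> a0" "adj T b3 x3" "x3 \<noteq> a0" by blast
    obtain y2 where y2: "N x2 = {y2, b2}" "N y2 = {x2}" using pend[of b2 x2] x by blast
    obtain y3 where y3: "N x3 = {y3, b3}" "N y3 = {x3}" using pend[of b3 x3] x by blast
    have x23: "x2 \<noteq> x3" using no4[of a0 b2 x2 b3] x hub b(2) adj_sym[of T] by blast
    have xA: "x2 \<in> A" "x3 \<in> A" using adj_BA x B by blast+
    have yB: "y2 \<in> B" "y3 \<in> B" using adj_AB[OF adjI[OF y2(1)] xA(1)] adj_AB[OF adjI[OF y3(1)] xA(2)] by auto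
    have "y2 \<noteq> y3" using y2(2) y3(2) x23 by auto
    moreover have "y2 \<notin> {b1, b2, b3}" "y3 \<notin> {b1, b2, b3}"
      using N_iff[OF y2(2), of a0] N_iff[OF y3(2), of a0] adjI[OF b1] hub x by auto
    ultimately have d: "distinct [y2, x2, b2, a0, b3, x3, y3, b1]"
      using b x x23 B xA yB a0(1) disj by auto
    show ?thesis
    proof (rule extremal_even_B[OF d y2(2) y2(1) b(1) _ y3(2) b1])
      show "N x3 = {b3, y3}" using y3 by auto
      show "\<not> adj T b2 b3" using adj_BA[of b2 b3] B disj by blast
      show "\<exists>y. N x = {y, p} \<and> N y = {x}"
        if "p \<in> {b2, b3}" "adj T p x" "x \<notin> {y2, x2, b2, a0, b3, x3, y3, b1}" for p x
        using pend[OF that(1,2)] that(3) by auto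
    qed
  qed
qed

section \<open>Colour classes of equal size\<close>

text \<open>The slack \<open>card A - k\<close> is 1, so two vertices cannot be dropped together.
  \<open>M\<close> is the choice of edges that would cover their neighbours.\<close>

lemma no_drop2:
  assumes k: "card A = k + 1" and pq: "p \<in> A" "q \<in> A" "p \<noteq> q" and sv: "single_valued M"
    and M: "\<And>a b. (a, b) \<in> M \<Longrightarrow> a \<in> A \<and> a \<noteq> p \<and> a \<noteq> q \<and> adj T a b"
    and rng: "\<And>b. adj T p b \<or> adj T q b \<Longrightarrow> b \<in> Range M"
  shows False
proof -
  have "k + card {p, q} \<le> card A"
    by (rule card_drop[OF _ sv]) (use pq M rng in auto)
  then show False using k pq(3) by simp
qed

text \<open>The leaf a is dropped together with a second vertex q of degree 2. If b has degree at
  least 3, it turns out to be the centre of a spider with extra leaf a. If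
  \<open>N b = {a, x}\<close>, the tree begins with the path a, b, x, c: either all other neighbours
  of c carry leaves and c is a hub of family (a), or the path runs on through c and q to the hub e
  of family (c).\<close>

lemma single_leaf_case:
  assumes k: "card A = k + 1" and n4: "card (verts T) \<noteq> 4"
    and a: "a \<in> A" "N a = {b}" and deg: "\<And>q. q \<in> A \<Longrightarrow> q \<noteq> a \<Longrightarrow> card (N q) = 2"
  shows "extremal_even T"
proof -
  have ab: "adj T a b" "adj T b a" using adjI[OF a(2)] adjI'[OF a(2)] by auto
  have bB: "b \<in> B" using adj_AB[OF ab(1) a(1)] .
  have N_A: "x \<in> A" if "adj T y x" "y \<in> B" for x y using adj_BA that by blast
  have na: "\<not> adj T a y" "\<not> adj T y a" if "y \<noteq> b" for y
    using N_iff[OF a(2), of y] N_iff'[OF a(2), of y] that by auto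
  \<comment> \<open>a and q share the neighbour b, so only b and b2 have to be covered. Unless one
    of the alternatives holds, there are substitutes x and y, and they differ because x = y closes
    the 4-cycle q, b, x, b2.\<close>
  have near: "N b = {a, q} \<or> N b2 = {q}" if q: "adj T b q" "q \<noteq> a" "N q = {b, b2}" "b \<noteq> b2" for q b2
  proof (rule ccontr)
    assume neg: "\<not> ?thesis"
    have qA: "q \<in> A" using N_A[OF q(1) bB] .
    have qb2: "adj T q b2" "adj T b2 q" using adjI[OF q(3)] adjI'[OF q(3)] by auto
    have b2B: "b2 \<in> B" using adj_AB[OF qb2(1) qA] .
    have "\<exists>x. adj T b x \<and> x \<noteq> a \<and> x \<noteq> q" using neg ab(2) q(1) by blast
    then obtain x where x: "adj T b x" "x \<noteq> a" "x \<noteq> q" by blast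
    have "\<exists>y. adj T b2 y \<and> y \<noteq> q" using neg qb2 by blast
    then obtain y where y: "adj T b2 y" "y \<noteq> q" by blast
    have xb: "adj T x b" "adj T y b2" using x y adj_sym[of T] by metis+
    have "x \<noteq> y" using no4[of q b x b2] q(1,4) x y xb qb2 adj_sym[of T q b] by blast
    show False
    proof (rule no_drop2[OF k a(1) qA q(2)[symmetric], of "{(x, b), (y, b2)}"])
      show "single_valued {(x, b), (y, b2)}" using \<open>x \<noteq> y\<close> by (auto simp: single_valued_def)
      show "a' \<in> A \<and> a' \<noteq> a \<and> a' \<noteq> q \<and> adj T a' b'" if "(a', b') \<in> {(x, b), (y, b2)}" for a' b'
        using that x y xb N_A[OF x(1) bB] N_A[OF y(1) b2B] na(2)[OF q(4)[symmetric]] by auto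
      show "b' \<in> Range {(x, b), (y, b2)}" if "adj T a b' \<or> adj T q b'" for b'
        using that N_iff[OF a(2)] N_iff[OF q(3)] by auto
    qed
  qed
  \<comment> \<open>Now b, b1 and b2 need substitutes x, y, z. The last two differ automatically,
    but x may coincide with one of them; the second alternative records this clash.\<close>
  have far: "(\<exists>y. N y = {q}) \<or> (\<exists>x c. N b = {a, x} \<and> adj T q c \<and> N c = {q, x})"
    if q: "q \<in> A" "q \<noteq> a" "\<not> adj T b q" for q
  proof (rule ccontr)
    assume neg: "\<not> ?thesis"
    obtain b1 b2 where bb: "N q = {b1, b2}" "b1 \<noteq> b2" using deg[OF q(1,2)] by (auto simp: card_2_iff)
    have qb: "adj T q b1" "adj T b1 q" "adj T q b2" "adj T b2 q" using adjI[OF bb(1)] adjI'[OF bb(1)] by auto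
    have bbB: "b1 \<in> B" "b2 \<in> B" using adj_AB qb q(1) by blast+
    have bne: "b1 \<noteq> b" "b2 \<noteq> b" using qb q(3) by auto
    have "\<exists>y. adj T c y \<and> y \<noteq> q" if "adj T c q" for c using neg that by blast
    then obtain y z where y: "adj T b1 y" "y \<noteq> q" and z: "adj T b2 z" "z \<noteq> q" using qb by metis
    have cover: "x = y \<or> x = z"
      if h: "adj T b x" "x \<noteq> a" "adj T b1 y" "y \<noteq> q" "adj T b2 z" "z \<noteq> q" for x y z
    proof (rule ccontr)
      assume ne: "\<not> (x = y \<or> x = z)"
      have sy: "adj T x b" "adj T y b1" "adj T z b2" using h adj_sym[of T] by metis+
      have "y \<noteq> z" using no4[of q b1 y b2] qb h sy bb(2) by blast
      show False
      proof (rule no_drop2[OF k a(1) q(1) q(2)[symmetric], of "{(x, b), (y, b1), (z, b2)}"])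
        show "single_valued {(x, b), (y, b1), (z, b2)}"
          using \<open>y \<noteq> z\<close> ne by (auto simp: single_valued_def)
        show "a' \<in> A \<and> a' \<noteq> a \<and> a' \<noteq> q \<and> adj T a' b'"
          if "(a', b') \<in> {(x, b), (y, b1), (z, b2)}" for a' b'
          using that h sy N_A[OF h(1) bB] N_A[OF h(3) bbB(1)] N_A[OF h(5) bbB(2)]
            na(2)[OF bne(1)] na(2)[OF bne(2)] q(3) by auto
        show "b' \<in> Range {(x, b), (y, b1), (z, b2)}" if "adj T a b' \<or> adj T q b'" for b'
          using that N_iff[OF a(2)] N_iff[OF bb(1)] by auto
      qed
    qed
    have yz: "y \<noteq> z" using no4[of q b1 y b2] qb y z bb(2) adj_sym[of T] by blast
    \<comment> \<open>If b were adjacent to both, b, y, b1, q, b2, z would be a 6-cycle. So b has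
      only one neighbour besides a, and varying the substitute at the clashing neighbour of q shows
      that it has no further neighbour either.\<close>
    have six: "\<not> (adj T b y \<and> adj T b z)"
      using no6[of b y b1 q b2 z] qb y z bb(2) bne q(3) yz adj_sym[of T] by auto
    obtain x where x: "adj T b x" "x \<noteq> a" using leaf_nbr_other[OF a(2)] .
    have xy: "x = y \<or> x = z" using cover[OF x y z] .
    show False
    proof (cases "x = y")
      case True
      then have "N b = {a, x}" using cover[OF _ _ y z] six x ab(2) by blast
      moreover have "w = x" if "adj T b1 w" "w \<noteq> q" for w using cover[OF x that z] True yz by blast
      then have "N b1 = {q, x}" using True y qb by blast
      ultimately show False using neg qb by blast
    next
      case False
      then have xz: "x = z" using xy by blast
      then have "N b = {a, x}" using cover[OF _ _ y z] six x ab(2) by blast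
      moreover have "w = x" if "adj T b2 w" "w \<noteq> q" for w using cover[OF x y that] False by blast
      then have "N b2 = {q, x}" using xz z qb by blast
      ultimately show False using neg qb by blast
    qed
  qed
  obtain x where x: "adj T b x" "x \<noteq> a" using leaf_nbr_other[OF a(2)] .
  have xA: "x \<in> A" using N_A[OF x(1) bB] .
  show ?thesis
  proof (cases "N b = {a, x}")
    case False
    show ?thesis
    proof (rule extremal_even_spider_center[OF a(2)])
      fix q assume q: "adj T b q" "q \<noteq> a"
      have "b \<in> N q" using q adj_sym[of T b q] by auto
      then obtain b2 where b2: "N q = {b, b2}" "b \<noteq> b2"
        using card_2_otherE[OF deg[OF N_A[OF q(1) bB] q(2)]] by metis
      have "N b \<noteq> {a, q}" using False x by auto
      then have "N b2 = {q}" using near[OF q b2] by blast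
      then show "\<exists>y. N q = {y, b} \<and> N y = {q}" using b2 by (intro exI[of _ b2]) auto
    qed
  next
    case Nb: True
    have "b \<in> N x" using x adj_sym[of T b x] by auto
    then obtain c where c: "N x = {b, c}" "b \<noteq> c"
      using card_2_otherE[OF deg[OF xA x(2)]] by metis
    have xc: "adj T x c" "adj T c x" using adjI[OF c(1)] adjI'[OF c(1)] by auto
    have cB: "c \<in> B" using adj_AB[OF xc(1) xA] .
    \<comment> \<open>Since \<open>N b = {a, x}\<close>, a clash can occur only at x, and its link
      to q must be c, the other neighbour of x.\<close>
    have far': "(\<exists>y. N y = {q}) \<or> N c = {q, x}" if q: "q \<in> A" "q \<noteq> a" "q \<noteq> x" for q
    proof -
      have nb: "\<not> adj T b q" using N_iff[OF Nb, of q] q by auto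
      from far[OF q(1,2) nb] show ?thesis
      proof
        assume "\<exists>x c. N b = {a, x} \<and> adj T q c \<and> N c = {q, x}"
        then obtain x' c' where h: "N b = {a, x'}" "adj T q c'" "N c' = {q, x'}" by blast
        have "x' = x" using h(1) Nb x(2) by (auto simp: doubleton_eq_iff)
        then have "c' \<in> {b, c}" using N_iff'[OF h(3), of x] N_iff[OF c(1), of c'] by auto
        moreover have "c' \<noteq> b" using h(2) nb adj_sym[of T q b] by auto
        ultimately show ?thesis using h(3) \<open>x' = x\<close> by auto
      qed blast
    qed
    show ?thesis
    proof (cases "\<exists>q. adj T c q \<and> q \<noteq> x \<and> (\<nexists>y. N y = {q})")
      case False
      have pend: "\<exists>y. N q = {y, c} \<and> N y = {q}" if q: "adj T c q" "q \<noteq> x" for q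
      proof -
        have qA: "q \<in> A" using N_A[OF q(1) cB] .
        have qa: "q \<noteq> a" using q(1) na(2)[OF c(2)[symmetric]] by auto
        obtain y where y: "N y = {q}" using False q by blast
        have "y \<noteq> c" using N_iff[OF y, of x] xc q by auto
        moreover have "adj T q c" using q(1) adj_sym by metis
        ultimately have "N q = {y, c}" using deg[OF qA qa] adjI'[OF y] by (intro card_2_eqD) auto
        then show ?thesis using y by blast
      qed
      \<comment> \<open>Otherwise the tree is the path a, b, x, c, whose order \<open>n4\<close>
        excludes.\<close>
      have "\<exists>q. adj T c q \<and> q \<noteq> x"
      proof (rule ccontr)
        assume "\<not> ?thesis"
        then have "N c = {x}" using xc by blast
        then have "verts T \<subseteq> {a, b, x, c}"
          using N_iff[OF a(2)] N_iff[OF Nb] N_iff[OF c(1)] N_iff[OF \<open>N c = {x}\<close>] a(1) V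
          by (intro closed_set[of a]) auto
        moreover have "{a, b, x, c} \<subseteq> verts T" using V a(1) bB xA cB by auto
        ultimately have "verts T = {a, b, x, c}" by blast
        moreover have "distinct [a, b, x, c]" using a(1) bB xA cB x(2) c(2) disj by auto
        ultimately have "card (verts T) = 4" using distinct_card[of "[a, b, x, c]"] by simp
        then show False using n4 by simp
      qed
      then obtain q where q: "adj T c q" "q \<noteq> x" by blast
      obtain y where y: "N q = {y, c}" "N y = {q}" using pend[OF q] by blast
      have qA: "q \<in> A" using N_A[OF q(1) cB] .
      have yB: "y \<in> B" using adj_AB[OF adjI[OF y(1)] qA] by simp
      have qa: "q \<noteq> a" using q(1) na(2)[OF c(2)[symmetric]] by auto
      have ycb: "y \<noteq> c" "y \<noteq> b" using N_iff[OF y(2), of x] xc q(2) x by auto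
      have d: "distinct [a, b, x, c, q, y]"
        using a(1) bB xA cB qA yB x(2) c(2) q(2) qa ycb disj by auto
      show ?thesis
      proof (rule extremal_even_A[OF d a(2) Nb _ y(2) xc(1)])
        show "N q = {c, y}" using y(1) by auto
        show "\<exists>z. N w = {z, p} \<and> N z = {w}"
          if h: "p \<in> {x, c}" "adj T p w" "w \<notin> {a, b, x, c, q, y}" for p w
        proof -
          have "p = c" using h N_iff[OF c(1), of w] by auto
          then show ?thesis using pend[of w] h by auto
        qed
      qed
    next
      case True
      then obtain q where q: "adj T c q" "q \<noteq> x" and noleaf: "\<nexists>y. N y = {q}" by blast
      have qA: "q \<in> A" using N_A[OF q(1) cB] .
      have qa: "q \<noteq> a" using q(1) na(2)[OF c(2)[symmetric]] by auto
      have Nc: "N c = {q, x}" using far'[OF qA qa q(2)] noleaf by blast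
      have "c \<in> N q" using q(1) adj_sym[of T c q] by auto
      then obtain e where e: "N q = {c, e}" "c \<noteq> e" using card_2_otherE[OF deg[OF qA qa]] by metis
      have qe: "adj T q e" "adj T e q" using adjI[OF e(1)] adjI'[OF e(1)] by auto
      have eB: "e \<in> B" using adj_AB[OF qe(1) qA] .
      have eb: "e \<noteq> b" using qe N_iff[OF Nb, of q] qa q(2) by auto
      have pend: "\<exists>y. N w = {y, e} \<and> N y = {w}" if w: "adj T e w" "w \<noteq> q" for w
      proof -
        have wA: "w \<in> A" using N_A[OF w(1) eB] .
        have wa: "w \<noteq> a" using w(1) na(2)[OF eb] by auto
        have wx: "w \<noteq> x" using w(1) N_iff'[OF c(1), of e] eb e(2) by auto
        \<comment> \<open>This rules out the clash alternative for w, because c is already used up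
          by q and x.\<close>
        have "N c \<noteq> {w, x}" using Nc w(2) q(2) by auto
        then obtain y where y: "N y = {w}" using far'[OF wA wa wx] by blast
        have "y \<noteq> e" using N_iff[OF y, of q] qe w by auto
        moreover have "adj T w e" using w(1) adj_sym by metis
        ultimately have "N w = {y, e}" using deg[OF wA wa] adjI'[OF y] by (intro card_2_eqD) auto
        then show ?thesis using y by blast
      qed
      have "\<exists>w. adj T e w \<and> w \<noteq> q" using noleaf qe by blast
      then obtain w where w: "adj T e w" "w \<noteq> q" by blast
      obtain y where y: "N w = {y, e}" "N y = {w}" using pend[OF w] by blast
      have wA: "w \<in> A" using N_A[OF w(1) eB] .
      have wa: "w \<noteq> a" using w(1) na(2)[OF eb] by auto
      have wx: "w \<noteq> x" using w(1) N_iff'[OF c(1), of e] eb e(2) by auto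
      have yB: "y \<in> B" using adj_AB[OF adjI[OF y(1)] wA] by simp
      have yne: "y \<noteq> c" "y \<noteq> b" "y \<noteq> e"
        using N_iff[OF y(2), of x] N_iff[OF y(2), of q] xc qe w(2) wx x by auto
      have d: "distinct [a, b, x, c, q, e, w, y]"
        using a(1) bB xA cB qA eB wA yB x(2) c(2) q(2) qa e(2) eb w(2) wa wx yne disj by auto
      show ?thesis
      proof (rule extremal_even_C[OF d a(2) Nb _ e(1) _ y(2)])
        show "N c = {x, q}" using Nc by auto
        show "N w = {e, y}" using y(1) by auto
        show "\<exists>z. N v = {z, p} \<and> N z = {v}"
          if h: "p \<in> {x, e}" "adj T p v" "v \<notin> {a, b, x, c, q, e, w, y}" for p v
        proof -
          have "p = e" using h N_iff[OF c(1), of v] by auto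
          then show ?thesis using pend[of v] h by auto
        qed
      qed
    qed
  qed
qed

text \<open>Dropping the two leaves requires substitutes for b1 and b2 only. If b1 = b2, one
  substitute suffices, and it is missing only in the path of order 3. If they differ, every
  substitute for b1 must coincide with every substitute for b2, so each has exactly one, and it is
  common to both.\<close>

lemma two_leaves:
  assumes k: "card A = k + 1" and n3: "card (verts T) \<noteq> 3"
    and a: "a1 \<in> A" "a2 \<in> A" "a1 \<noteq> a2" "N a1 = {b1}" "N a2 = {b2}"
  obtains h where "N b1 = {a1, h}" "N b2 = {a2, h}" "h \<noteq> a1" "h \<noteq> a2"
proof -
  have ab: "adj T a1 b1" "adj T b1 a1" "adj T a2 b2" "adj T b2 a2"
    using adjI[OF a(4)] adjI'[OF a(4)] adjI[OF a(5)] adjI'[OF a(5)] by auto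
  have bB: "b1 \<in> B" "b2 \<in> B" using adj_AB ab a by blast+
  have bne: "b1 \<noteq> b2"
  proof
    assume eq: "b1 = b2"
    show False
    proof (cases "\<exists>w. adj T b1 w \<and> w \<noteq> a1 \<and> w \<noteq> a2")
      case True
      then obtain w where w: "adj T b1 w" "w \<noteq> a1" "w \<noteq> a2" by blast
      have w': "adj T w b1" "w \<in> A" using w(1) adj_sym[of T b1 w] adj_BA[OF w(1) bB(1)] by auto
      show False
        by (rule no_drop2[OF k a(1-3), of "{(w, b1)}"])
          (use w w' eq N_iff[OF a(4)] N_iff[OF a(5)] in \<open>auto simp: single_valued_def\<close>)
    next
      case False
      then have "N b1 = {a1, a2}" using ab eq by blast
      then have "verts T \<subseteq> {a1, b1, a2}"
        using N_iff[OF a(4)] N_iff[OF a(5)] N_iff[OF \<open>N b1 = {a1, a2}\<close>] eq a(1) V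
        by (intro closed_set[of a1]) auto
      then have "card (verts T) \<le> card {a1, b1, a2}" by (intro card_mono) auto
      also have "\<dots> \<le> 3" by (simp add: card_insert_if)
      finally show False using n3 card3 by simp
    qed
  qed
  have same: "w1 = w2" if w: "adj T b1 w1" "w1 \<noteq> a1" "adj T b2 w2" "w2 \<noteq> a2" for w1 w2
  proof (rule ccontr)
    assume ne: "w1 \<noteq> w2"
    have w': "adj T w1 b1" "w1 \<in> A" "adj T w2 b2" "w2 \<in> A"
      using w adj_sym[of T] adj_BA bB by blast+
    have "w1 \<noteq> a2" "w2 \<noteq> a1" using w' N_iff[OF a(4)] N_iff[OF a(5)] bne by auto
    then show False
      using no_drop2[OF k a(1-3), of "{(w1, b1), (w2, b2)}"] w w' ne N_iff[OF a(4)] N_iff[OF a(5)]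
      by (auto simp: single_valued_def)
  qed
  obtain w1 where w1: "adj T b1 w1" "w1 \<noteq> a1" using leaf_nbr_other[OF a(4)] .
  obtain w2 where w2: "adj T b2 w2" "w2 \<noteq> a2" using leaf_nbr_other[OF a(5)] .
  have "N b1 = {a1, w1}" using same[OF _ _ w2] w1 ab by blast
  moreover have "N b2 = {a2, w1}" using same[OF w1] w2 ab by blast
  moreover have "w1 \<noteq> a2" using w1(1) N_iff'[OF a(5), of b1] bne by auto
  ultimately show ?thesis using that w1(2) by blast
qed

text \<open>The hub is determined by b1 alone, so comparing every other leaf with a1 always yields
  the same vertex.\<close>

lemma hub_exists:
  assumes k: "card A = k + 1" and n3: "card (verts T) \<noteq> 3"
    and a: "a1 \<in> A" "a2 \<in> A" "a1 \<noteq> a2" "N a1 = {b1}" "N a2 = {b2}"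
  obtains h where "h \<in> A" "\<And>a b. a \<in> A \<Longrightarrow> N a = {b} \<Longrightarrow> N b = {a, h} \<and> h \<noteq> a"
proof -
  obtain h where h: "N b1 = {a1, h}" "N b2 = {a2, h}" "h \<noteq> a1" "h \<noteq> a2"
    using two_leaves[OF assms] .
  have "b1 \<in> B" using adj_AB[OF adjI[OF a(4)] a(1)] by simp
  then have "h \<in> A" using adj_BA[OF adjI[OF h(1)]] by simp
  moreover have "N b = {a, h} \<and> h \<noteq> a" if leaf: "a \<in> A" "N a = {b}" for a b
  proof (cases "a = a1")
    case True
    then have "b = b1" using leaf a(4) by auto
    then show ?thesis using h True by auto
  next
    case False
    obtain h' where h': "N b1 = {a1, h'}" "N b = {a, h'}" "h' \<noteq> a1" "h' \<noteq> a"
      using two_leaves[OF k n3 a(1) leaf(1) False[symmetric] a(4) leaf(2)] .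
    then have "h' = h" using h by (auto simp: doubleton_eq_iff)
    then show ?thesis using h' by simp
  qed
  ultimately show ?thesis using that by blast
qed

text \<open>a1 and q are dropped, with the edge \<open>{h, b1}\<close> reserved for covering b1. If
  each neighbour of q had a neighbour besides q and h, these would be substitutes, different from
  each other by the absence of 4-cycles and from h by choice.\<close>

lemma hub_drop:
  assumes k: "card A = k + 1" and a1: "a1 \<in> A" "N a1 = {b1}" "N b1 = {a1, h}" "h \<in> A" "h \<noteq> a1"
    and q: "q \<in> A" "q \<noteq> a1" "q \<noteq> h"
  obtains b where "adj T q b" "N b \<subseteq> {q, h}"
proof -
  have "\<exists>b. adj T q b \<and> N b \<subseteq> {q, h}"
  proof (rule ccontr)
    assume no: "\<not> ?thesis"
    have "\<exists>c. adj T b c \<and> c \<noteq> q \<and> c \<noteq> h" if "adj T q b" for b using no that by blast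
    then obtain g where g: "\<And>b. adj T q b \<Longrightarrow> adj T b (g b) \<and> g b \<noteq> q \<and> g b \<noteq> h" by metis
    have qb1: "\<not> adj T q b1" using N_iff'[OF a1(3), of q] q by auto
    let ?M = "insert (h, b1) ((\<lambda>b. (g b, b)) ` N q)"
    show False
    proof (rule no_drop2[OF k a1(1) q(1) q(2)[symmetric], of ?M])
      have "b = b'" if bb: "adj T q b" "adj T q b'" "g b = g b'" for b b'
      proof (rule ccontr)
        assume "b \<noteq> b'"
        moreover have "adj T b (g b)" "adj T (g b) b'" "adj T b' q" "g b \<noteq> q"
          using g[OF bb(1)] g[OF bb(2)] bb adj_sym[of T] by metis+
        ultimately show False using no4[OF bb(1)] by blast
      qed
      then show "single_valued ?M" using g by (auto simp: single_valued_def)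
      show "x \<in> A \<and> x \<noteq> a1 \<and> x \<noteq> q \<and> adj T x b" if xb: "(x, b) \<in> ?M" for x b
      proof (cases "(x, b) = (h, b1)")
        case True
        then show ?thesis using a1 q adjI'[OF a1(3)] by auto
      next
        case False
        then have b: "adj T q b" "x = g b" using xb by auto
        have bx: "adj T b x" "x \<noteq> q" "adj T x b" using g[OF b(1)] b(2) adj_sym[of T b x] by auto
        have "x \<in> A" using adj_BA[OF bx(1) adj_AB[OF b(1) q(1)]] .
        moreover have "x \<noteq> a1" using bx(3) N_iff[OF a1(2), of b] b(1) qb1 by auto
        ultimately show ?thesis using bx by blast
      qed
      show "b \<in> Range ?M" if "adj T a1 b \<or> adj T q b" for b
        using that N_iff[OF a1(2), of b] by auto
    qed
  qed
  then show ?thesis using that by blast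
qed

text \<open>The degree sum 2k + 1 over k + 1 vertices is one too small for all degrees to reach 2,
  so there is a leaf. If it is the only one, the other k vertices have degree at least 2 and sum
  2k.\<close>

lemma leaf_dichotomy:
  assumes k: "card A = k + 1" "card B = k + 1"
  obtains (single) a b where "a \<in> A" "N a = {b}" "\<And>q. q \<in> A \<Longrightarrow> q \<noteq> a \<Longrightarrow> card (N q) = 2"
  | (multiple) a1 a2 b1 b2 where "a1 \<in> A" "a2 \<in> A" "a1 \<noteq> a2" "N a1 = {b1}" "N a2 = {b2}"
proof -
  have sum: "(\<Sum>a\<in>A. card (N a)) = 2 * k + 1" using degree_sum k by simp
  have pos: "card (N a) \<ge> 1" if "a \<in> A" for a
    using N_nonempty[of a] V that finite_N[of a] by (auto simp: Suc_le_eq card_gt_0_iff)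
  have one: "\<exists>b. N a = {b}" if "card (N a) = 1" for a using that by (auto simp: card_1_singleton_iff)
  have less2: "card (N a) = 1" if "a \<in> A" "card (N a) < 2" for a using pos that by fastforce
  have "\<exists>a\<in>A. card (N a) < 2"
  proof (rule ccontr)
    assume "\<not> ?thesis"
    then have "(\<Sum>a\<in>A. 2) \<le> (\<Sum>a\<in>A. card (N a))" by (intro sum_mono) auto
    then show False using sum k by simp
  qed
  then obtain a where a: "a \<in> A" "card (N a) = 1" using less2 by blast
  obtain b where b: "N a = {b}" using one[OF a(2)] by blast
  show ?thesis
  proof (cases "\<exists>q\<in>A. q \<noteq> a \<and> card (N q) < 2")
    case True
    then obtain q where q: "q \<in> A" "q \<noteq> a" "card (N q) = 1" using less2 by blast
    obtain b' where "N q = {b'}" using one[OF q(3)] by blast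
    then show ?thesis using multiple[of a q] a q b by blast
  next
    case False
    have sum': "(\<Sum>q\<in>A - {a}. card (N q)) = 2 * card (A - {a})"
      using sum sum.remove[OF finA a(1), of "\<lambda>a. card (N a)"] a k by simp
    have "card (N q) = 2" if "q \<in> A" "q \<noteq> a" for q
      by (rule sum_eq_twice_cardD[OF _ _ sum']) (use finA False that in auto)
    then show ?thesis using single[OF a(1) b] by blast
  qed
qed

end

text \<open>Vertices \<open>a\<^sub>i\<close> and \<open>y\<^sub>i\<close> are leaves in the two colour classes, with neighbours \<open>b\<^sub>i\<close> and
  \<open>x\<^sub>i\<close>; all leaves of \<^term>\<open>A\<close> hang at distance two from \<^term>\<open>h\<close>, all leaves of \<^term>\<open>B\<close> at
  distance two from \<^term>\<open>g\<close>.\<close>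

locale two_hubs = bipartite_tree +
  fixes h g a1 a2 b1 b2 y1 y2 x1 x2 :: 'a
  assumes kA: "card A = k + 1" and kB: "card B = k + 1"
    and h: "h \<in> A" "\<And>a b. a \<in> A \<Longrightarrow> N a = {b} \<Longrightarrow> N b = {a, h} \<and> h \<noteq> a"
    and a: "a1 \<in> A" "a2 \<in> A" "a1 \<noteq> a2" "N a1 = {b1}" "N a2 = {b2}"
    and g: "g \<in> B" "\<And>y x. y \<in> B \<Longrightarrow> N y = {x} \<Longrightarrow> N x = {y, g} \<and> g \<noteq> y"
    and y: "y1 \<in> B" "y2 \<in> B" "y1 \<noteq> y2" "N y1 = {x1}" "N y2 = {x2}"
begin

lemma swap_hubs: "two_hubs T B A k g h y1 y2 x1 x2 a1 a2 b1 b2"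
  by (intro two_hubs.intro two_hubs_axioms.intro swap) (fact kA kB h a g y)+

lemma Nb: "N b1 = {a1, h}" "N b2 = {a2, h}" "h \<noteq> a1" "h \<noteq> a2" "b1 \<noteq> b2"
  and Nx: "N x1 = {y1, g}" "N x2 = {y2, g}" "g \<noteq> y1" "g \<noteq> y2" "x1 \<noteq> x2"
  and hb: "adj T h b1" "adj T h b2"
  and gx: "adj T g x1" "adj T g x2"
proof -
  show Nb: "N b1 = {a1, h}" "N b2 = {a2, h}" "h \<noteq> a1" "h \<noteq> a2" using h(2)[OF a(1,4)] h(2)[OF a(2,5)] by simp_all
  show Nx: "N x1 = {y1, g}" "N x2 = {y2, g}" "g \<noteq> y1" "g \<noteq> y2" using g(2)[OF y(1,4)] g(2)[OF y(2,5)] by simp_all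
  show "b1 \<noteq> b2" using Nb a(3) by (metis doubleton_eq_iff)
  show "x1 \<noteq> x2" using Nx y(3) by (metis doubleton_eq_iff)
  show "adj T h b1" "adj T h b2" using adjI'[OF Nb(1)] adjI'[OF Nb(2)] by auto
  show "adj T g x1" "adj T g x2" using adjI'[OF Nx(1)] adjI'[OF Nx(2)] by auto
qed

text \<open>The neighbours b1 and b2 of h are distinct and neither is a leaf, whereas x1 and x2 each
  have a leaf among their only two neighbours.\<close>

lemma mid_neq_hub: "x1 \<noteq> h" "x2 \<noteq> h"
proof -
  have leaf: "y' \<noteq> b1 \<and> y' \<noteq> b2" if "N y' = {x'}" for y' x'
    using that Nb by (metis doubleton_eq_iff insert_absorb2)
  have "y1 \<notin> {b1, b2}" "y2 \<notin> {b1, b2}" using leaf[OF y(4)] leaf[OF y(5)] by auto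
  then show "x1 \<noteq> h" "x2 \<noteq> h"
    using N_iff[OF Nx(1)] N_iff[OF Nx(2)] hb Nb(5) by auto
qed

text \<open>This is \<open>hub_drop\<close> with the classes exchanged: y1 and w are dropped from B.
  The neighbour of w so obtained is either a leaf, which makes w the inner vertex of an attached
  edge, or a link from w to g.\<close>

lemma hub_nbr:
  assumes w: "adj T h w" "w \<noteq> g"
  shows "(\<exists>a. N w = {a, h} \<and> N a = {w}) \<or> (\<exists>a. a \<noteq> h \<and> N a = {w, g} \<and> adj T w a)"
proof -
  interpret S: bipartite_tree T B A k by (rule swap)
  have wB: "w \<in> B" using adj_AB[OF w(1) h(1)] .
  have "w \<noteq> y1" using N_iff'[OF y(4), of h] w(1) mid_neq_hub by auto
  obtain a where a': "adj T w a" "N a \<subseteq> {w, g}"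
    using S.hub_drop[OF kB y(1,4) Nx(1) g(1) Nx(3) wB \<open>w \<noteq> y1\<close> w(2)] .
  have aA: "a \<in> A" using adj_BA[OF a'(1) wB] .
  have aw: "adj T a w" using a'(1) adj_sym by metis
  show ?thesis
  proof (cases "adj T a g")
    case False
    then have "N a = {w}" using a'(2) aw by blast
    then show ?thesis using h(2)[OF aA] by blast
  next
    case True
    then have Na: "N a = {w, g}" using a'(2) aw by blast
    \<comment> \<open>For a = h, one of b1 and b2 would be g. Then x1 would be one of the leaves a1,
      a2, although it has the two neighbours y1 and g.\<close>
    have "a \<noteq> h"
    proof
      assume "a = h"
      then have "{b1, b2} \<subseteq> {w, g}" using hb Na by auto
      then have "g = b1 \<or> g = b2" using Nb(5) by auto
      then have "{x1, x2} \<subseteq> {a1, h} \<or> {x1, x2} \<subseteq> {a2, h}" using Nb(1,2) gx by auto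
      then have "x1 \<in> {a1, a2}" using mid_neq_hub by auto
      then have "\<exists>z. N x1 = {z}" using a by auto
      then show False using Nx(1,3) by auto
    qed
    then show ?thesis using Na a'(1) by blast
  qed
qed

text \<open>By \<open>hub_nbr\<close> for both classes, a neighbour of one hub, other than the
  opposite hub, either starts an attached edge or lies on a link to the opposite hub. If the hubs
  are adjacent, a link would close a 4-cycle, and family (a) results. If not, there is a link h, w,
  a, g, a second one would close a 6-cycle, and family (c) results.\<close>

lemma two_hubs_case: "extremal_even T"
proof -
  interpret S: two_hubs T B A k g h y1 y2 x1 x2 a1 a2 b1 b2 by (rule swap_hubs)
  have bB: "b1 \<in> B" using adj_AB[OF hb(1) h(1)] .
  have xA: "x1 \<in> A" using adj_BA[OF gx(1) g(1)] .
  have x1a1: "x1 \<noteq> a1" using Nx(1,3) a(4) by auto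
  have y1b1: "y1 \<noteq> b1" using Nb(1,3) y(4) by auto
  have hubs: "adj T g h \<longleftrightarrow> adj T h g" by (rule adj_sym)
  show ?thesis
  proof (cases "adj T h g")
    case True
    have d: "distinct [a1, b1, h, g, x1, y1]"
      using a(1) h(1) xA bB g(1) y(1) Nb(3) Nx(3) mid_neq_hub(1) S.mid_neq_hub(1) x1a1 y1b1 disj
      by auto
    show ?thesis
    proof (rule extremal_even_A[OF d a(4) Nb(1) _ y(4) True])
      show "N x1 = {g, y1}" using Nx(1) by auto
      fix p x assume px: "p \<in> {h, g}" "adj T p x" "x \<notin> {a1, b1, h, g, x1, y1}"
      show "\<exists>z. N x = {z, p} \<and> N z = {x}"
      proof (cases "p = h")
        case True
        have "\<not> (\<exists>a. a \<noteq> h \<and> N a = {x, g} \<and> adj T x a)"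
        proof (clarify)
          fix a assume a: "a \<noteq> h" "N a = {x, g}" "adj T x a"
          show False
            using no4[of h x a g] px True a adjI[OF a(2)] \<open>adj T h g\<close> hubs by auto
        qed
        then show ?thesis using hub_nbr[of x] px True by auto
      next
        case False
        then have pg: "p = g" using px by auto
        have "\<not> (\<exists>b. b \<noteq> g \<and> N b = {x, h} \<and> adj T x b)"
        proof (clarify)
          fix b assume b: "b \<noteq> g" "N b = {x, h}" "adj T x b"
          show False
            using no4[of g x b h] px pg b adjI[OF b(2)] \<open>adj T h g\<close> by auto
        qed
        then show ?thesis using S.hub_nbr[of x] px pg by auto
      qed
    qed
  next
    case nhg: False
    \<comment> \<open>Without such a w, the hub h, its neighbours and their leaves would be the
      whole tree. Then g, not being adjacent to h, would be one of these leaves and adjacent to a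
      vertex of its own class.\<close>
    have "\<exists>w. adj T h w \<and> (\<nexists>a. N w = {a, h} \<and> N a = {w})"
    proof (rule ccontr)
      assume all: "\<not> ?thesis"
      let ?S = "{h} \<union> N h \<union> {a. \<exists>w. adj T h w \<and> N a = {w}}"
      have "verts T \<subseteq> ?S"
      proof (rule closed_set[of h])
        fix x z assume x: "x \<in> ?S" and xz: "adj T x z"
        then consider "x = h" | "adj T h x" | w where "adj T h w" "N x = {w}" by blast
        then show "z \<in> ?S"
        proof cases
          case 2
          then obtain a where a: "N x = {a, h}" "N a = {x}" using all by blast
          then have "z = a \<or> z = h" using N_iff[OF a(1), of z] xz by simp
          then show ?thesis using 2 a(2) by blast
        next
          case 3
          then have "z = w" using N_iff[OF 3(2), of z] xz by simp
          then show ?thesis using 3 by blast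
        qed (use xz in auto)
      qed (use h V in auto)
      then have "g \<in> ?S" using g(1) V by blast
      moreover have "g \<noteq> h" using g(1) h(1) disj by auto
      ultimately obtain w where w: "adj T h w" "N g = {w}" using nhg by blast
      have "adj T g w" using adjI[OF w(2)] by simp
      then have "w \<in> A" "w \<in> B" using adj_BA g(1) adj_AB[OF w(1) h(1)] by auto
      then show False using disj by auto
    qed
    then obtain w where w: "adj T h w" "\<nexists>a. N w = {a, h} \<and> N a = {w}" by blast
    have wg: "w \<noteq> g" using w nhg by auto
    obtain a where a': "a \<noteq> h" "N a = {w, g}" "adj T w a" using hub_nbr[OF w(1) wg] w(2) by blast
    have wB: "w \<in> B" using adj_AB[OF w(1) h(1)] .
    have aA: "a \<in> A" using adj_BA[OF a'(3) wB] .
    have wh: "adj T w h" using w(1) adj_sym by metis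
    have ga: "adj T g a" using adjI'[OF a'(2)] by simp
    \<comment> \<open>The first alternative at a would make w a leaf, against its edge to h. The
      second is a link from a back to h, and because of \<open>N a = {w, g}\<close> it must pass
      through w.\<close>
    have Nw: "N w = {h, a}"
      using S.hub_nbr[OF ga a'(1)]
    proof (elim disjE exE conjE)
      fix z assume z: "N a = {z, g}" "N z = {a}"
      then have "z = w" using a'(2) wg by (auto simp: doubleton_eq_iff)
      then show ?thesis using z(2) wh a'(1) by auto
    next
      fix b assume b: "b \<noteq> g" "N b = {a, h}" "adj T a b"
      then have "b = w" using N_iff[OF a'(2), of b] by auto
      then show ?thesis using b(2) by auto
    qed
    have aa1: "a \<noteq> a1" using a'(2) a(4) wg by auto
    have wy1: "w \<noteq> y1" using Nw y(4) a'(1) by auto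
    have ax1: "a \<noteq> x1" using a'(2) Nx(1) wg wy1 by (auto simp: doubleton_eq_iff)
    have wb1: "w \<noteq> b1" using Nw Nb(1) aa1 a'(1) by (auto simp: doubleton_eq_iff)
    have d: "distinct [a1, b1, h, w, a, g, x1, y1]"
      using a(1) h(1) xA bB g(1) y(1) Nb(3) Nx(3) mid_neq_hub(1) S.mid_neq_hub(1) x1a1 y1b1
        wB aA wg a'(1) aa1 wy1 ax1 wb1 disj
      by auto
    show ?thesis
    proof (rule extremal_even_C[OF d a(4) Nb(1) Nw a'(2) _ y(4)])
      show "N x1 = {g, y1}" using Nx(1) by auto
      fix p x assume px: "p \<in> {h, g}" "adj T p x" "x \<notin> {a1, b1, h, w, a, g, x1, y1}"
      have xp: "adj T x p" using px(2) adj_sym by metis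
      show "\<exists>z. N x = {z, p} \<and> N z = {x}"
      proof (cases "p = h")
        case True
        have "\<not> (\<exists>a. a \<noteq> h \<and> N a = {x, g} \<and> adj T x a)"
        proof (clarify)
          fix c assume c: "c \<noteq> h" "N c = {x, g}" "adj T x c"
          have "c \<noteq> a" using c(2) a'(2) px(3) wg by (auto simp: doubleton_eq_iff)
          then show False
            using no6[of h w a g c x] px(3) xp True c adjI[OF c(2)] adjI'[OF c(2)] w(1) a' adjI[OF a'(2)] wg
            by auto
        qed
        then show ?thesis using hub_nbr[of x] px True by auto
      next
        case False
        then have pg: "p = g" using px by auto
        have "\<not> (\<exists>b. b \<noteq> g \<and> N b = {x, h} \<and> adj T x b)"
        proof (clarify)
          fix b assume b: "b \<noteq> g" "N b = {x, h}" "adj T x b"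
          have "b \<noteq> w" using b(2) Nw px(3) a'(1) by (auto simp: doubleton_eq_iff)
          then show False
            using no6[of g a w h b x] px(3) xp pg b adjI[OF b(2)] adjI'[OF b(2)] wh ga a' adjI[OF a'(2)] wg
            by auto
        qed
        then show ?thesis using S.hub_nbr[of x] px pg by auto
      qed
    qed
  qed
qed

end

context bipartite_tree
begin

lemma even_case_balanced:
  assumes k: "card A = k + 1" "card B = k + 1" and n4: "card (verts T) \<noteq> 4"
  shows "extremal_even T"
proof -
  interpret S: bipartite_tree T B A k by (rule swap)
  have n3: "card (verts T) \<noteq> 3" using card_V k by presburger
  show ?thesis
  proof (cases rule: leaf_dichotomy[OF k])
    case (1 a b)
    then show ?thesis using single_leaf_case[OF k(1) n4] by blast
  next
    case a: (2 a1 a2 b1 b2)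
    show ?thesis
    proof (cases rule: S.leaf_dichotomy[OF k(2,1)])
      case (1 a b)
      then show ?thesis using S.single_leaf_case[OF k(2) n4] by blast
    next
      case y: (2 y1 y2 x1 x2)
      obtain h where h: "h \<in> A" "\<And>a b. a \<in> A \<Longrightarrow> N a = {b} \<Longrightarrow> N b = {a, h} \<and> h \<noteq> a"
        using hub_exists[OF k(1) n3 a] by blast
      obtain g where g: "g \<in> B" "\<And>a b. a \<in> B \<Longrightarrow> N a = {b} \<Longrightarrow> N b = {a, g} \<and> g \<noteq> a"
        using S.hub_exists[OF k(2) n3 y] by blast
      interpret two_hubs T A B k h g a1 a2 b1 b2 y1 y2 x1 x2
        by unfold_locales (fact k h a g y)+
      show ?thesis by (rule two_hubs_case)
    qed
  qed
qed

lemma edges_eq: "edges T = (\<Union>a\<in>A. (\<lambda>b. {a, b}) ` N a)"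
proof
  show "edges T \<subseteq> (\<Union>a\<in>A. (\<lambda>b. {a, b}) ` N a)" by (auto elim!: edgeE)
qed (auto simp: adj_def)

section \<open>The theorem\<close>

lemma N_eq_B_if_card_A_1:
  assumes "A = {a}"
  shows "N a = B"
proof (rule card_subset_eq[OF finB])
  show "N a \<subseteq> B" using adj_AB assms by auto
  show "card (N a) = card B" using degree_sum assms by simp
qed

lemma star_if_card_A_1:
  assumes "card A = 1"
  shows "graph_iso T (star_graph (card B))"
proof -
  obtain a where a: "A = {a}" using assms by (rule card_1_singletonE)
  show ?thesis
  proof (rule graph_iso_star[of T a B])
    show "edges T = {{a, l} | l. l \<in> B}"
      unfolding edges_eq using N_eq_B_if_card_A_1[OF a] a by auto
  qed (use a V disj finB in auto)
qed

lemma path_3_if_card_A_1: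
  assumes "card A = 1" "card B = 2"
  shows "graph_iso T (path_graph 3)"
proof -
  obtain a where a: "A = {a}" using assms(1) by (rule card_1_singletonE)
  obtain b c where b: "B = {b, c}" "b \<noteq> c" using assms(2) by (auto simp: card_2_iff)
  have "edges T = {{b, a}, {a, c}}"
    unfolding edges_eq using N_eq_B_if_card_A_1[OF a] a b by auto
  then have "edges T = edges (path_on [b, a, c])"
    by (simp add: edges_path_on_Cons_Cons edges_path_on_single)
  then have "T = path_on [b, a, c]" using V a b by (intro graph.expand) (auto simp: verts_path_on)
  moreover have "distinct [b, a, c]" using a b disj by auto
  ultimately show ?thesis using graph_iso_path_on[of "[b, a, c]"] by (simp add: eval_nat_numeral)
qed

lemma path_4_if_balanced:
  assumes k: "card A = k + 1" "card B = k + 1" and "k = 1"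
  shows "graph_iso T (path_graph 4)"
proof -
  have small: "graph_iso T (path_graph 4)"
    if a: "a \<in> A" "N a = {b}" and q: "q \<in> A" "q \<noteq> a" "card (N q) = 2" for a b q
  proof -
    have A: "A = {a, q}" using a q k \<open>k = 1\<close> by (intro card_2_eqD) auto
    have bB: "b \<in> B" using adj_AB[OF adjI[OF a(2)] a(1)] by simp
    obtain c where c: "B = {b, c}" "b \<noteq> c" using card_2_otherE[OF _ bB] k \<open>k = 1\<close> by auto
    have "N q = B"
      by (rule card_subset_eq[OF finB]) (use adj_AB q k \<open>k = 1\<close> in auto)
    then have "edges T = {{a, b}, {b, q}, {q, c}}" unfolding edges_eq using A a(2) c by auto
    then have "edges T = edges (path_on [a, b, q, c])"
      by (simp add: edges_path_on_Cons_Cons edges_path_on_single)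
    then have "T = path_on [a, b, q, c]" using V A c by (intro graph.expand) (auto simp: verts_path_on)
    moreover have "distinct [a, b, q, c]" using A c q disj by auto
    ultimately show ?thesis using graph_iso_path_on[of "[a, b, q, c]"] by (simp add: eval_nat_numeral)
  qed
  have n3: "card (verts T) \<noteq> 3" using card_V k by presburger
  show ?thesis
  proof (cases rule: leaf_dichotomy[OF k])
    case (1 a b)
    have "card (A - {a}) = 1" using 1(1) k \<open>k = 1\<close> by simp
    then obtain q where "A - {a} = {q}" by (rule card_1_singletonE)
    then have "q \<in> A" "q \<noteq> a" by auto
    then show ?thesis using small[OF 1(1,2)] 1(3) by blast
  next
    case (2 a1 a2 b1 b2)
    obtain h where h: "h \<in> A" "\<And>a b. a \<in> A \<Longrightarrow> N a = {b} \<Longrightarrow> N b = {a, h} \<and> h \<noteq> a"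
      using hub_exists[OF k(1) n3 2] by blast
    \<comment> \<open>Two leaves in A would bring in the hub as a third vertex, while A has only
      two.\<close>
    have "card {a1, a2, h} \<le> card A" using 2 h(1) finA by (intro card_mono) auto
    moreover have "h \<noteq> a1" "h \<noteq> a2" using h(2)[OF 2(1,4)] h(2)[OF 2(2,5)] by simp_all
    then have "card {a1, a2, h} = 3" using 2(3) by (simp add: card_insert_if eq_commute)
    ultimately show ?thesis using k \<open>k = 1\<close> by simp
  qed
qed

end

theorem theorem7:
  fixes T :: "'a graph" and n :: nat
  assumes "tree T"
    and "card (verts T) = n"
    and "n \<ge> 3"
    and "isolation_number (middle_graph T) = (n - 1) div 2"
  shows "(n \<le> 4 \<longrightarrow> graph_iso T (path_graph n) \<or> graph_iso T (star_graph 3)) \<and>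
    (n \<ge> 5 \<and> odd n \<longrightarrow> (n - 1) div 2 \<ge> 2 \<and> graph_iso T (spider ((n - 1) div 2))) \<and>
    (n \<ge> 6 \<and> even n \<and> diam T \<le> 4 \<longrightarrow>
       (\<exists>w. leaf T w \<and> (\<exists>k\<ge>2. graph_iso (delete_vertex T w) (spider k)))) \<and>
    (n \<ge> 6 \<and> even n \<and> diam T \<ge> 5 \<longrightarrow>
       (\<exists>u. length u = 6 \<and> distinct u \<and>
            attach_edges (path_on u) {u ! 2, u ! 3} T) \<or>
       (\<exists>u v. length u = 7 \<and> distinct u \<and> v \<notin> set u \<and>
            attach_edges (add_leaf (path_on u) (u ! 3) v) {u ! 2, u ! 4} T) \<or>
       (\<exists>u. length u = 8 \<and> distinct u \<and>
            attach_edges (path_on u) {u ! 2, u ! 5} T))"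
proof -
  define k where "k = (n - 1) div 2"
  obtain A' B' where AB: "A' \<inter> B' = {}" "verts T = A' \<union> B'"
    "edges T \<subseteq> {{a, b} | a b. a \<in> A' \<and> b \<in> B'}"
    using tree_bipartite_card_edges[OF assms(1)] .
  have sg: "simple_graph T" using assms(1) by (simp add: tree_def)
  have dom: "k \<le> card F" if "F \<subseteq> edges T" "\<And>e. e \<in> edges T \<Longrightarrow> \<exists>f\<in>F. e \<inter> f \<noteq> {}" for F
    using isolation_number_middle_graph_le[OF sg that] assms(4) by (simp add: k_def)
  have bt: "bipartite_tree T A' B' k"
    by unfold_locales (use assms(1-3) AB dom in auto)
  obtain A B where bt: "bipartite_tree T A B k" and AB_le: "card A \<le> card B"
    using bt bipartite_tree.swap[OF bt] that by (meson nat_le_linear)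
  interpret bipartite_tree T A B k by (rule bt)
  have n: "n = card A + card B" using card_V assms(2) by simp
  have kA: "k \<le> card A" by (rule k_le_card_A)
  \<comment> \<open>Undoing the rounding gives n = 2k + 1 for odd n and n = 2k + 2 for even n; k
    \<le> |A| \<le> |B| then leaves one pair of sizes in the odd case and two in the even
    case.\<close>
  have odd: "card A = k" "card B = k + 1" if "odd n"
  proof -
    have "n = 2 * k + 1" using that assms(3) by (auto simp: k_def elim: oddE)
    then show "card A = k" "card B = k + 1" using n kA AB_le by linarith+
  qed
  have even: "card A = k \<and> card B = k + 2 \<or> card A = k + 1 \<and> card B = k + 1" if "even n"
  proof -
    have "n = 2 * k + 2" using that assms(3) unfolding k_def by presburger
    then show ?thesis using n kA AB_le by linarith
  qed
  have 1: "graph_iso T (path_graph n) \<or> graph_iso T (star_graph 3)" if "n \<le> 4"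
  proof -
    from that assms(3) consider "n = 3" | "n = 4" by linarith
    then show ?thesis
    proof cases
      case 1
      then have "k = 1" by (simp add: k_def)
      then show ?thesis using path_3_if_card_A_1 odd 1 by simp
    next
      case 2
      then have k: "k = 1" by (simp add: k_def)
      have "even n" using 2 by simp
      from even[OF this] show ?thesis
      proof (elim disjE conjE)
        assume "card A = k" "card B = k + 2"
        then show ?thesis using star_if_card_A_1 k by (simp add: numeral_3_eq_3)
      next
        assume "card A = k + 1" "card B = k + 1"
        then show ?thesis using path_4_if_balanced k 2 by simp
      qed
    qed
  qed
  have 2: "k \<ge> 2 \<and> graph_iso T (spider k)" if "n \<ge> 5" "odd n"
  proof -
    note oddn = odd[OF that(2)]
    obtain c where "attach_edges (Graph {c} {}) {c} T" using odd_case[OF oddn] .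
    then obtain r where r: "graph_iso T (spider r)" "card (verts T) = 2 * r + 1"
      by (rule attach_edges_star_spider)
    have "r = k" using r(2) assms(2) by (simp add: k_def)
    then show ?thesis using r that assms(2) by auto
  qed
  have ext: "extremal_even T" if "n \<ge> 6" "even n"
    using even[OF that(2)] even_case_unbalanced even_case_balanced that(1) assms(2) by auto
  have 3: "\<exists>w. leaf T w \<and> (\<exists>k\<ge>2. graph_iso (delete_vertex T w) (spider k))"
    if "n \<ge> 6" "even n" "diam T \<le> 4"
  proof -
    have "spider_with_leaf T" using ext that by (auto simp: extremal_even_def)
    then obtain w c where w: "leaf T w" "attach_edges (Graph {c} {}) {c} (delete_vertex T w)"
      by (auto simp: spider_with_leaf_def)
    obtain r where r: "graph_iso (delete_vertex T w) (spider r)" "card (verts (delete_vertex T w)) = 2 * r + 1"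
      using attach_edges_star_spider[OF w(2)] .
    have "card (verts (delete_vertex T w)) = n - 1"
      using w(1) assms(2) by (simp add: delete_vertex_def leaf_def)
    \<comment> \<open>The remaining order n - 1 = 2r + 1 is at least 5.\<close>
    then have "r \<ge> 2" using r(2) that(1) by linarith
    then show ?thesis using w(1) r(1) by blast
  qed
  have 4: "long_family T" if "n \<ge> 6" "even n" "diam T \<ge> 5"
    using ext that by (auto simp: extremal_even_def)
  show ?thesis using 1 2 3 4 unfolding k_def long_family_def by blast
qed

end
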